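(* Let $n \ge 4$ and let $\rho: B_{n+1} \to GL_{n+1}(\mathbb{C})$ be an irreducible representation of $B_{n+1}$ of dimension $n+1$. Suppose that there is a nonzero vector $v \in \mathbb{C}^{n+1}$ such that the one-dimensional subspace $\mathbb{C}v$ is invariant under $\rho(\sigma_1), \dots, \rho(\sigma_{n-2})$ and $\rho(\sigma_n)$ (i.e. under the restriction of $\rho$ to the subgroup $B_{n-1} \times \langle \sigma_n \rangle$ generated by $\sigma_1,\dots,\sigma_{n-2},\sigma_n$). Then there exists $y \in \mathbb{C}^*$ such that $\mathrm{rank}(\rho(\sigma_1) - yI) = 2$. *)

theory Defs
  imports "Jordan_Normal_Form.DL_Rank"
begin

text \<open>A representation of the braid group on m strands (generators sigma_1 .. sigma_(m-1))
  of dimension d is determined by the images s i (i = 1..m-1) of the standard generators: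
  invertible d x d complex matrices satisfying the Artin braid relations.\<close>
definition braid_rep :: "nat \<Rightarrow> nat \<Rightarrow> (nat \<Rightarrow> complex mat) \<Rightarrow> bool" where
  "braid_rep m d s \<longleftrightarrow>
     (\<forall>i\<in>{1..<m}. s i \<in> carrier_mat d d \<and> invertible_mat (s i)) \<and>
     (\<forall>i\<in>{1..<m}. \<forall>j\<in>{1..<m}. i + 2 \<le> j \<longrightarrow> s i * s j = s j * s i) \<and>
     (\<forall>i. 1 \<le> i \<and> i + 1 < m \<longrightarrow> s i * s (i+1) * s i = s (i+1) * s i * s (i+1))"

definition cplx_subspace :: "nat \<Rightarrow> complex vec set \<Rightarrow> bool" where
  "cplx_subspace d W \<longleftrightarrow> W \<subseteq> carrier_vec d \<and> 0\<^sub>v d \<in> W \<and>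
     (\<forall>u\<in>W. \<forall>w\<in>W. u + w \<in> W) \<and> (\<forall>c. \<forall>w\<in>W. c \<cdot>\<^sub>v w \<in> W)"

text \<open>Irreducible: the only subspaces invariant under the image of the braid group
  (equivalently, in finite dimension, under all generator images) are 0 and the whole space.\<close>
definition irreducible_braid_rep :: "nat \<Rightarrow> nat \<Rightarrow> (nat \<Rightarrow> complex mat) \<Rightarrow> bool" where
  "irreducible_braid_rep m d s \<longleftrightarrow> braid_rep m d s \<and> 0 < d \<and>
     (\<forall>W. cplx_subspace d W \<and> (\<forall>i\<in>{1..<m}. \<forall>w\<in>W. s i *\<^sub>v w \<in> W)
          \<longrightarrow> W = {0\<^sub>v d} \<or> W = carrier_vec d)"

end

theory Submission
  imports Defs
begin

text \<open>
  Put $T = \sigma_1 \cdots \sigma_n$. Conjugation by $T$ sends $\sigma_i$ to $\sigma_{i+1}$, and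
  $T^2 \sigma_n = \sigma_1 T^2$, so $B_0 = \sigma_1$, $B_{j+1} = T B_j T^{-1}$ is a cyclic sequence of
  period $n+1$ in which non-adjacent members commute. Let $x$ be the common eigenvalue of
  $\sigma_1, \dots, \sigma_{n-2}$ on $v$, let $M_j = B_j - x$ and let $E_k$ be the common kernel of all
  $M_j$ with $j$ different from $k-1$, $k$, $k+1$. A power of $T$ moves $v$ into $E_0$.

  Suppose first that $M_{k+1} M_{k-1}$ vanishes on $E_k$. Then the vectors $y$ with $M_k y \in E_k$
  for all $k$ form a nonzero invariant subspace, so $I_k = \mathrm{im}\, M_k \subseteq E_k$ for
  all $k$. As $E_0 \cap E_2 = 0$, the space $I_0 + I_1 + I_2$ has dimension at least $2r$, where $r$ is
  the rank, and the sums $I_0 + \dots + I_{m-1}$ grow strictly up to $m = n-1$. Hence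
  $2r + (n-4) \le n+1$ and $r \le 2$.

  Otherwise take $u_0 \in E_0$ not killed by $M_1 M_{-1}$ and put $u_k = T^k u_0$. The operator
  $M_{k+1} M_{k-1}$ kills every $u_i$ with $i \ne k$ but not $u_k$, so these $n+1$ vectors form a
  basis. If $M_0 u_0 = 0$, then $M_0$ kills all of them but two and $r \le 2$. If not,
  commutation forces the line of $u_2$ to be invariant, which contradicts irreducibility.

  Finally $r \ge 2$, because for $r \le 1$ the $n$ images of the $M_j$ lie in a common hyperplane,
  which is then invariant.
\<close>

section \<open>Linear algebra in coordinates\<close>

text \<open>Square, so that the determinant decides whether \<open>u 0\<close>, ...,
  \<open>u (d-1)\<close> form a basis; a shorter family has to be padded with zero vectors.\<close>

definition col_mat :: "nat \<Rightarrow> (nat \<Rightarrow> complex vec) \<Rightarrow> complex mat" where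
  "col_mat d u = mat d d (\<lambda>(r, k). u k $ r)"

lemma col_mat_carrier [simp]: "col_mat d u \<in> carrier_mat d d"
  by (simp add: col_mat_def)

lemma dim_col_mat [simp]: "dim_row (col_mat d u) = d" "dim_col (col_mat d u) = d"
  by (simp_all add: col_mat_def)

lemma col_mat_mult_index:
  assumes "a \<in> carrier_vec d" "r < d"
  shows "(col_mat d u *\<^sub>v a) $ r = (\<Sum>k<d. a $ k * u k $ r)"
  using assms by (auto simp: col_mat_def scalar_prod_def lessThan_atLeast0 intro!: sum.cong)

lemma mult_col_mat_index:
  assumes "N \<in> carrier_mat d d" "\<And>k. k < d \<Longrightarrow> u k \<in> carrier_vec d" "a \<in> carrier_vec d" "r < d"
  shows "(N *\<^sub>v (col_mat d u *\<^sub>v a)) $ r = (\<Sum>k<d. a $ k * (N *\<^sub>v u k) $ r)"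
proof -
  have "(N *\<^sub>v (col_mat d u *\<^sub>v a)) $ r = (\<Sum>j<d. N $$ (r, j) * (\<Sum>k<d. a $ k * u k $ j))"
    using assms
    by (subst index_mult_mat_vec)
      (auto simp: scalar_prod_def[of "row N r"] lessThan_atLeast0[symmetric] col_mat_mult_index
        simp del: index_mult_mat_vec intro!: sum.cong)
  also have "\<dots> = (\<Sum>k<d. \<Sum>j<d. N $$ (r, j) * (a $ k * u k $ j))"
    by (subst sum.swap) (simp add: sum_distrib_left)
  also have "\<dots> = (\<Sum>k<d. a $ k * (N *\<^sub>v u k) $ r)"
  proof (intro sum.cong refl)
    fix k assume "k \<in> {..<d}"
    then have "dim_vec (u k) = d" using assms(2)[of k] by simp
    then show "(\<Sum>j<d. N $$ (r, j) * (a $ k * u k $ j)) = a $ k * (N *\<^sub>v u k) $ r"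
      using assms(1,4)
      by (auto simp: scalar_prod_def lessThan_atLeast0 sum_distrib_left ac_simps intro!: sum.cong)
  qed
  finally show ?thesis .
qed

text \<open>All summands but one drop out. \<open>N\<close> acts as a coordinate functional when it
  kills the other vectors; with the identity as \<open>N\<close>, the lemma collapses a combination
  whose other coefficients vanish.\<close>

lemma mult_col_mat_single:
  assumes N: "N \<in> carrier_mat d d" and u: "\<And>k. k < d \<Longrightarrow> u k \<in> carrier_vec d"
    and a: "a \<in> carrier_vec d" and i: "i < d"
    and z: "\<And>k. k < d \<Longrightarrow> k \<noteq> i \<Longrightarrow> a $ k = 0 \<or> N *\<^sub>v u k = 0\<^sub>v d"
  shows "N *\<^sub>v (col_mat d u *\<^sub>v a) = a $ i \<cdot>\<^sub>v (N *\<^sub>v u i)"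
proof (rule eq_vecI)
  fix r assume "r < dim_vec (a $ i \<cdot>\<^sub>v (N *\<^sub>v u i))"
  then have r: "r < d" using N by simp
  have "(N *\<^sub>v (col_mat d u *\<^sub>v a)) $ r = (\<Sum>k<d. a $ k * (N *\<^sub>v u k) $ r)"
    by (rule mult_col_mat_index[OF N u a r])
  also have "\<dots> = (\<Sum>k\<in>{i}. a $ k * (N *\<^sub>v u k) $ r)"
    using i z r by (intro sum.mono_neutral_right) force+
  finally show "(N *\<^sub>v (col_mat d u *\<^sub>v a)) $ r = (a $ i \<cdot>\<^sub>v (N *\<^sub>v u i)) $ r"
    using N r by simp
qed (use N in simp)

lemma mult_col_mat_pair:
  assumes N: "N \<in> carrier_mat d d" and u: "\<And>k. k < d \<Longrightarrow> u k \<in> carrier_vec d"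
    and a: "a \<in> carrier_vec d" and i: "i < d" "j < d" "i \<noteq> j"
    and z: "\<And>k. k < d \<Longrightarrow> k \<noteq> i \<Longrightarrow> k \<noteq> j \<Longrightarrow> a $ k = 0 \<or> N *\<^sub>v u k = 0\<^sub>v d"
  shows "N *\<^sub>v (col_mat d u *\<^sub>v a) = a $ i \<cdot>\<^sub>v (N *\<^sub>v u i) + a $ j \<cdot>\<^sub>v (N *\<^sub>v u j)"
proof (rule eq_vecI)
  fix r assume "r < dim_vec (a $ i \<cdot>\<^sub>v (N *\<^sub>v u i) + a $ j \<cdot>\<^sub>v (N *\<^sub>v u j))"
  then have r: "r < d" using N by simp
  have "(N *\<^sub>v (col_mat d u *\<^sub>v a)) $ r = (\<Sum>k<d. a $ k * (N *\<^sub>v u k) $ r)"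
    by (rule mult_col_mat_index[OF N u a r])
  also have "\<dots> = (\<Sum>k\<in>{i, j}. a $ k * (N *\<^sub>v u k) $ r)"
    using i z r by (intro sum.mono_neutral_right) force+
  finally show "(N *\<^sub>v (col_mat d u *\<^sub>v a)) $ r
      = (a $ i \<cdot>\<^sub>v (N *\<^sub>v u i) + a $ j \<cdot>\<^sub>v (N *\<^sub>v u j)) $ r"
    using N r i by simp
qed (use N in simp)

text \<open>A trivial kernel makes the determinant nonzero, and a right inverse \<open>Q\<close>
  then yields the coordinates \<open>Q *\<^sub>v w\<close>.\<close>

lemma col_mat_surj:
  assumes inj: "\<And>a. a \<in> carrier_vec d \<Longrightarrow> col_mat d u *\<^sub>v a = 0\<^sub>v d \<Longrightarrow> a = 0\<^sub>v d"
    and w: "w \<in> carrier_vec d"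
  obtains a where "a \<in> carrier_vec d" "w = col_mat d u *\<^sub>v a"
proof -
  have "det (col_mat d u) \<noteq> 0"
    using inj det_0_iff_vec_prod_zero[OF col_mat_carrier] by blast
  from det_non_zero_imp_unit[OF col_mat_carrier this]
  obtain Q where Q: "Q \<in> carrier_mat d d" "col_mat d u * Q = 1\<^sub>m d"
    by (auto simp: Units_def ring_mat_def)
  have "w = col_mat d u *\<^sub>v (Q *\<^sub>v w)"
    using Q w assoc_mult_mat_vec[OF col_mat_carrier[of d u] Q(1) w] by simp
  then show thesis using that[of "Q *\<^sub>v w"] Q w by auto
qed

section \<open>Lower bounds for dimensions\<close>

text \<open>For a subspace \<open>W\<close> of \<open>carrier_vec d\<close> this says that its
  dimension is at least \<open>k\<close>. The family is indexed, so a repeated vector counts as a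
  dependence.\<close>

definition has_independent :: "nat \<Rightarrow> nat \<Rightarrow> complex vec set \<Rightarrow> bool" where
  "has_independent d k W \<longleftrightarrow> (\<exists>g. (\<forall>i<k. g i \<in> W) \<and>
     (\<forall>c. (\<forall>r<d. (\<Sum>i<k. c i * g i $ r) = 0) \<longrightarrow> (\<forall>i<k. c i = 0)))"

lemma has_independent_0: "has_independent d 0 W"
  by (simp add: has_independent_def)

text \<open>With more than \<open>d\<close> members, the first \<open>d\<close> would form a basis
  and the member of index \<open>d\<close> would be a combination of them.\<close>

lemma has_independent_le:
  assumes h: "has_independent d k W" and W: "W \<subseteq> carrier_vec d"
  shows "k \<le> d"
proof (rule ccontr)
  assume "\<not> k \<le> d"
  then have kd: "d < k" by simp
  obtain g where g: "\<And>i. i < k \<Longrightarrow> g i \<in> W"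
    and li: "\<And>c. (\<And>r. r < d \<Longrightarrow> (\<Sum>i<k. c i * g i $ r) = 0) \<Longrightarrow> \<forall>i<k. c i = 0"
    using h unfolding has_independent_def by metis
  \<comment> \<open>Coefficients on the first \<open>d\<close> members are extended by zero to all
    \<open>k\<close>, which transfers independence to the square matrix.\<close>
  have ext: "(\<Sum>i<k. (if i < d then f i else 0)) = sum f {..<d}" for f :: "nat \<Rightarrow> complex"
    using kd by (intro sum.mono_neutral_cong_right) auto
  have inj: "a = 0\<^sub>v d" if a: "a \<in> carrier_vec d" and z: "col_mat d g *\<^sub>v a = 0\<^sub>v d" for a
  proof -
    have "(\<Sum>i<k. (if i < d then a $ i else 0) * g i $ r) = 0" if r: "r < d" for r
    proof -
      have "(\<Sum>i<k. (if i < d then a $ i else 0) * g i $ r) = (\<Sum>i<k. if i < d then a $ i * g i $ r else 0)"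
        by (intro sum.cong) auto
      also have "\<dots> = 0"
        unfolding ext using col_mat_mult_index[OF a r, of g] z r by simp
      finally show ?thesis .
    qed
    from li[OF this] have "a $ i = 0" if "i < d" for i
      using that less_trans[OF that kd] by (metis (full_types))
    then show ?thesis using a by (intro eq_vecI) auto
  qed
  have "g d \<in> carrier_vec d" using g[OF kd] W by blast
  then obtain a where a: "a \<in> carrier_vec d" and gd: "g d = col_mat d g *\<^sub>v a"
    using col_mat_surj[OF inj] by blast
  \<comment> \<open>The relation that expresses \<open>g d\<close> through the earlier members: -1
    at index \<open>d\<close>, zero beyond.\<close>
  define c where "c i = (if i < d then a $ i else if i = d then -1 else 0)" for i
  have "(\<Sum>i<k. c i * g i $ r) = 0" if r: "r < d" for r
  proof -
    have "(\<Sum>i<k. c i * g i $ r) = (\<Sum>i<Suc d. c i * g i $ r)"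
      using kd by (intro sum.mono_neutral_right) (auto simp: c_def)
    also have "\<dots> = (\<Sum>i<d. a $ i * g i $ r) - g d $ r"
      by (simp add: c_def)
    also have "\<dots> = 0" using col_mat_mult_index[OF a r, of g] gd by simp
    finally show ?thesis .
  qed
  from li[OF this] kd have "c d = 0" by auto
  then show False by (simp add: c_def)
qed

lemma cplx_subspace_sum:
  fixes k :: nat
  assumes W: "cplx_subspace d W" and g: "\<And>i. i < k \<Longrightarrow> g i \<in> W"
  shows "vec d (\<lambda>r. \<Sum>i<k. c i * g i $ r) \<in> W"
  using g
proof (induction k)
  case 0
  have "vec d (\<lambda>r. 0) = (0\<^sub>v d :: complex vec)" by auto
  then show ?case using W by (simp add: cplx_subspace_def)
next
  case (Suc k)
  have gk: "g k \<in> W" "g k \<in> carrier_vec d" using Suc.prems[of k] W by (auto simp: cplx_subspace_def)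
  have "vec d (\<lambda>r. \<Sum>i<Suc k. c i * g i $ r) = vec d (\<lambda>r. \<Sum>i<k. c i * g i $ r) + c k \<cdot>\<^sub>v g k"
    using gk by (intro eq_vecI) auto
  moreover have "vec d (\<lambda>r. \<Sum>i<k. c i * g i $ r) \<in> W" "c k \<cdot>\<^sub>v g k \<in> W"
    using Suc gk W by (auto simp: cplx_subspace_def)
  ultimately show ?case using W by (simp add: cplx_subspace_def)
qed

text \<open>A relation with a nonzero coefficient at \<open>b\<close> could be solved for
  \<open>b\<close>, which would put \<open>b\<close> into \<open>W\<close>.\<close>

lemma has_independent_Suc:
  assumes h: "has_independent d k W" and W: "cplx_subspace d W"
    and sub: "W \<subseteq> W'" and b: "b \<in> W'" "b \<notin> W" "b \<in> carrier_vec d"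
  shows "has_independent d (Suc k) W'"
proof -
  obtain g where g: "\<And>i. i < k \<Longrightarrow> g i \<in> W"
    and li: "\<And>c. (\<And>r. r < d \<Longrightarrow> (\<Sum>i<k. c i * g i $ r) = 0) \<Longrightarrow> \<forall>i<k. c i = 0"
    using h unfolding has_independent_def by metis
  define g' where "g' = g(k := b)"
  have split: "(\<Sum>i<Suc k. c i * g' i $ r) = (\<Sum>i<k. c i * g i $ r) + c k * b $ r" for c r
    by (simp add: g'_def)
  have "\<forall>i<Suc k. c i = 0" if z: "\<forall>r<d. (\<Sum>i<Suc k. c i * g' i $ r) = 0" for c
  proof -
    have ck: "c k = 0"
    proof (rule ccontr)
      assume nz: "c k \<noteq> 0"
      have "b = vec d (\<lambda>r. \<Sum>i<k. (- c i / c k) * g i $ r)"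
      proof (rule eq_vecI)
        fix r assume "r < dim_vec (vec d (\<lambda>r. \<Sum>i<k. (- c i / c k) * g i $ r))"
        then have r: "r < d" by simp
        have "c k * b $ r = - (\<Sum>i<k. c i * g i $ r)"
          using z r split[of c r] by (simp add: add_eq_0_iff)
        then have "b $ r = - (\<Sum>i<k. c i * g i $ r) / c k"
          using nz by (simp add: field_simps)
        then show "b $ r = vec d (\<lambda>r. \<Sum>i<k. (- c i / c k) * g i $ r) $ r"
          using r by (simp add: sum_negf sum_divide_distrib)
      qed (use b in simp)
      also have "\<dots> \<in> W" by (rule cplx_subspace_sum[OF W g])
      finally show False using b by simp
    qed
    have "(\<Sum>i<k. c i * g i $ r) = 0" if "r < d" for r
      using z that split[of c r] ck by simp
    then have "\<forall>i<k. c i = 0" by (rule li)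
    then show ?thesis using ck less_Suc_eq by auto
  qed
  moreover have "\<forall>i<Suc k. g' i \<in> W'" using g sub b by (auto simp: g'_def less_Suc_eq)
  ultimately show ?thesis unfolding has_independent_def by blast
qed

lemma cplx_subspace_line_extend:
  assumes W: "cplx_subspace d W" and b: "b \<in> carrier_vec d"
  shows "cplx_subspace d {a + \<beta> \<cdot>\<^sub>v b | a \<beta>. a \<in> W}"
  unfolding cplx_subspace_def
proof (intro conjI ballI allI)
  let ?S = "{a + \<beta> \<cdot>\<^sub>v b | a \<beta>. a \<in> W}"
  have Wc: "W \<subseteq> carrier_vec d" and W0: "0\<^sub>v d \<in> W"
    and Wa: "\<And>u w. u \<in> W \<Longrightarrow> w \<in> W \<Longrightarrow> u + w \<in> W" and Ws: "\<And>c w. w \<in> W \<Longrightarrow> c \<cdot>\<^sub>v w \<in> W"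
    using W by (auto simp: cplx_subspace_def)
  show "?S \<subseteq> carrier_vec d" using Wc b by auto
  have "0\<^sub>v d = 0\<^sub>v d + 0 \<cdot>\<^sub>v b" using b by auto
  then show "0\<^sub>v d \<in> ?S" using W0 by blast
  fix u w c
  assume u: "u \<in> ?S"
  from u obtain a \<alpha> where 1: "u = a + \<alpha> \<cdot>\<^sub>v b" "a \<in> W" by blast
  have "c \<cdot>\<^sub>v u = c \<cdot>\<^sub>v a + (c * \<alpha>) \<cdot>\<^sub>v b"
    using 1 Wc b by (auto simp: smult_add_distrib_vec[of _ d] smult_smult_assoc)
  then show "c \<cdot>\<^sub>v u \<in> ?S" using 1 Ws by blast
  assume "w \<in> ?S"
  then obtain a' \<beta> where 2: "w = a' + \<beta> \<cdot>\<^sub>v b" "a' \<in> W" by blast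
  have "u + w = (a + a') + (\<alpha> + \<beta>) \<cdot>\<^sub>v b"
    using 1 2 Wc b by (intro eq_vecI) (auto simp: algebra_simps)
  then show "u + w \<in> ?S" using 1 2 Wa by blast
qed

text \<open>Vectors that are independent modulo \<open>W\<close> are added one at a time, through
  \<open>W1\<close> and \<open>W2\<close>. There are three of them because a rank above 2 is refuted
  through three independent image vectors.\<close>

lemma has_independent_add3:
  assumes h: "has_independent d k W" and W: "cplx_subspace d W" and W': "cplx_subspace d W'"
    and sub: "W \<subseteq> W'" and b: "a \<in> W'" "b \<in> W'" "c \<in> W'"
    and li: "\<And>\<alpha> \<beta> \<gamma>. \<alpha> \<cdot>\<^sub>v a + \<beta> \<cdot>\<^sub>v b + \<gamma> \<cdot>\<^sub>v c \<in> W \<Longrightarrow> \<alpha> = 0 \<and> \<beta> = 0 \<and> \<gamma> = 0"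
  shows "has_independent d (k + 3) W'"
proof -
  have W'c: "W' \<subseteq> carrier_vec d"
    and W'a: "\<And>u w. u \<in> W' \<Longrightarrow> w \<in> W' \<Longrightarrow> u + w \<in> W'" and W's: "\<And>c w. w \<in> W' \<Longrightarrow> c \<cdot>\<^sub>v w \<in> W'"
    using W' by (auto simp: cplx_subspace_def)
  have car: "a \<in> carrier_vec d" "b \<in> carrier_vec d" "c \<in> carrier_vec d" using b W'c by auto
  have Wc: "W \<subseteq> carrier_vec d" using sub W'c by auto
  define W1 where "W1 = {w + \<beta> \<cdot>\<^sub>v a | w \<beta>. w \<in> W}"
  define W2 where "W2 = {w + \<beta> \<cdot>\<^sub>v b | w \<beta>. w \<in> W1}"
  have s1: "cplx_subspace d W1" unfolding W1_def by (rule cplx_subspace_line_extend[OF W car(1)])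
  have s2: "cplx_subspace d W2" unfolding W2_def by (rule cplx_subspace_line_extend[OF s1 car(2)])
  have incl: "X \<subseteq> {w + \<beta> \<cdot>\<^sub>v e | w \<beta>. w \<in> X}" "e \<in> {w + \<beta> \<cdot>\<^sub>v e | w \<beta>. w \<in> X}"
    if "cplx_subspace d X" "e \<in> carrier_vec d" for X e
  proof -
    have "w = w + 0 \<cdot>\<^sub>v e" if "w \<in> X" for w
      using that \<open>cplx_subspace d X\<close> \<open>e \<in> carrier_vec d\<close>
      by (intro eq_vecI) (auto simp: cplx_subspace_def)
    then show "X \<subseteq> {w + \<beta> \<cdot>\<^sub>v e | w \<beta>. w \<in> X}" by blast
    have "e = 0\<^sub>v d + 1 \<cdot>\<^sub>v e" using that by auto
    then show "e \<in> {w + \<beta> \<cdot>\<^sub>v e | w \<beta>. w \<in> X}" using that unfolding cplx_subspace_def by blast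
  qed
  have "a \<notin> W"
  proof
    assume "a \<in> W"
    moreover have "1 \<cdot>\<^sub>v a + 0 \<cdot>\<^sub>v b + 0 \<cdot>\<^sub>v c = a" using car by (intro eq_vecI) auto
    ultimately show False using li[of 1 0 0] by simp
  qed
  then have h1: "has_independent d (Suc k) W1"
    using has_independent_Suc[OF h W, of W1 a] incl[OF W car(1)] car unfolding W1_def by simp
  have "b \<notin> W1"
  proof
    assume "b \<in> W1"
    then obtain w \<beta> where w: "w \<in> W" "b = w + \<beta> \<cdot>\<^sub>v a" unfolding W1_def by blast
    have "(-\<beta>) \<cdot>\<^sub>v a + 1 \<cdot>\<^sub>v b + 0 \<cdot>\<^sub>v c = w" using car w Wc by (intro eq_vecI) auto
    then show False using li[of "-\<beta>" 1 0] w by simp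
  qed
  then have h2: "has_independent d (Suc (Suc k)) W2"
    using has_independent_Suc[OF h1 s1, of W2 b] incl[OF s1 car(2)] car unfolding W2_def by simp
  have "c \<notin> W2"
  proof
    assume "c \<in> W2"
    then obtain w \<beta> \<gamma> where w: "w \<in> W" "c = (w + \<beta> \<cdot>\<^sub>v a) + \<gamma> \<cdot>\<^sub>v b" unfolding W1_def W2_def by blast
    have "(-\<beta>) \<cdot>\<^sub>v a + (-\<gamma>) \<cdot>\<^sub>v b + 1 \<cdot>\<^sub>v c = w" using car w Wc by (intro eq_vecI) auto
    then show False using li[of "-\<beta>" "-\<gamma>" 1] w by simp
  qed
  moreover have "W2 \<subseteq> W'" using b sub W'a W's unfolding W1_def W2_def by blast
  ultimately have "has_independent d (Suc (Suc (Suc k))) W'"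
    using has_independent_Suc[OF h2 s2, of W' c] b car by simp
  then show ?thesis by (simp add: numeral_3_eq_3)
qed

section \<open>Rank and image of a matrix\<close>

lemma mult_mat_unit_vec:
  fixes N :: "complex mat"
  assumes "N \<in> carrier_mat d d" "i < d"
  shows "N *\<^sub>v unit_vec d i = col N i"
  using assms by (intro eq_vecI) auto

text \<open>The rank is the size of a maximal independent set of columns, and columns are the images
  of unit vectors.\<close>

lemma rank_ge_3_independent:
  assumes N: "N \<in> carrier_mat d d" and rank: "vec_space.rank d N \<ge> 3"
  obtains a b c where "a \<in> carrier_vec d" "b \<in> carrier_vec d" "c \<in> carrier_vec d"
    "\<And>\<alpha> \<beta> \<gamma> :: complex. \<alpha> \<cdot>\<^sub>v (N *\<^sub>v a) + \<beta> \<cdot>\<^sub>v (N *\<^sub>v b) + \<gamma> \<cdot>\<^sub>v (N *\<^sub>v c) = 0\<^sub>v d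
       \<Longrightarrow> \<alpha> = 0 \<and> \<beta> = 0 \<and> \<gamma> = 0"
proof -
  interpret V: vec_space "TYPE(complex)" d .
  have cols: "set (cols N) \<subseteq> carrier_vec d" using N cols_dim[of N] by auto
  have "V.lin_indpt {}" by (auto simp: V.lin_dep_def)
  then obtain S where S: "maximal S (\<lambda>T. T \<subseteq> set (cols N) \<and> V.lin_indpt T)"
    using maximal_exists_superset[of "set (cols N)" "\<lambda>T. T \<subseteq> set (cols N) \<and> V.lin_indpt T" "{}"] by auto
  then have SN: "S \<subseteq> set (cols N)" and li: "V.lin_indpt S" by (auto simp: maximal_def)
  have "3 \<le> card S" using V.rank_card_indpt[OF N S] rank by simp
  then obtain R where R: "R \<subseteq> S" "card R = 3" using obtain_subset_with_card_n by blast
  then obtain p q r where pqr: "R = {p, q, r}" "p \<noteq> q" "q \<noteq> r" "p \<noteq> r" by (metis card_3_iff)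
  have "\<exists>a \<in> carrier_vec d. N *\<^sub>v a = w" if "w \<in> S" for w
  proof -
    have "w \<in> set (cols N)" using that SN by auto
    then obtain i where "i < d" "w = col N i" using N by (auto simp: cols_def)
    then show ?thesis using mult_mat_unit_vec[OF N] by (intro bexI[of _ "unit_vec d i"]) auto
  qed
  moreover have "p \<in> S" "q \<in> S" "r \<in> S" using R pqr by auto
  ultimately have "\<exists>a \<in> carrier_vec d. N *\<^sub>v a = p" "\<exists>b \<in> carrier_vec d. N *\<^sub>v b = q"
    "\<exists>c \<in> carrier_vec d. N *\<^sub>v c = r" by simp_all
  then obtain a b c where abc: "a \<in> carrier_vec d" "b \<in> carrier_vec d" "c \<in> carrier_vec d"
    "N *\<^sub>v a = p" "N *\<^sub>v b = q" "N *\<^sub>v c = r" by (elim bexE)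
  have car: "R \<subseteq> carrier_vec d" using R SN cols by auto
  show thesis
  proof (rule that[OF abc(1-3)])
    fix \<alpha> \<beta> \<gamma> :: complex
    assume z: "\<alpha> \<cdot>\<^sub>v (N *\<^sub>v a) + \<beta> \<cdot>\<^sub>v (N *\<^sub>v b) + \<gamma> \<cdot>\<^sub>v (N *\<^sub>v c) = 0\<^sub>v d"
    define f where "f w = (if w = p then \<alpha> else if w = q then \<beta> else \<gamma>)" for w
    have "V.lincomb f R = 0\<^sub>v d"
    proof (rule eq_vecI)
      fix i assume "i < dim_vec (0\<^sub>v d :: complex vec)"
      then have i: "i < d" by simp
      have "V.lincomb f R $ i = (\<alpha> \<cdot>\<^sub>v p + \<beta> \<cdot>\<^sub>v q + \<gamma> \<cdot>\<^sub>v r) $ i"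
        unfolding V.lincomb_index[OF i car] using pqr i car by (auto simp: f_def)
      then show "V.lincomb f R $ i = 0\<^sub>v d $ i" using z abc by simp
    qed (use V.lincomb_dim[OF _ car] R card.infinite in fastforce)
    then have "\<forall>w\<in>R. f w = 0"
      using V.not_lindepD[OF li _ R(1), of f] R card.infinite by fastforce
    then show "\<alpha> = 0 \<and> \<beta> = 0 \<and> \<gamma> = 0" using pqr by (auto simp: f_def)
  qed
qed

lemma rank_le_2I:
  assumes N: "N \<in> carrier_mat d d" and p: "p \<in> carrier_vec d" "q \<in> carrier_vec d"
    and im: "\<And>y. y \<in> carrier_vec d \<Longrightarrow> \<exists>\<alpha> \<beta> :: complex. N *\<^sub>v y = \<alpha> \<cdot>\<^sub>v p + \<beta> \<cdot>\<^sub>v q"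
  shows "vec_space.rank d N \<le> 2"
proof (rule ccontr)
  assume "\<not> vec_space.rank d N \<le> 2"
  then have "vec_space.rank d N \<ge> 3" by simp
  from rank_ge_3_independent[OF N this] obtain a b c where
    abc: "a \<in> carrier_vec d" "b \<in> carrier_vec d" "c \<in> carrier_vec d"
    and li: "\<And>\<alpha> \<beta> \<gamma> :: complex. \<alpha> \<cdot>\<^sub>v (N *\<^sub>v a) + \<beta> \<cdot>\<^sub>v (N *\<^sub>v b) + \<gamma> \<cdot>\<^sub>v (N *\<^sub>v c) = 0\<^sub>v d
       \<Longrightarrow> \<alpha> = 0 \<and> \<beta> = 0 \<and> \<gamma> = 0" by metis
  obtain a1 a2 b1 b2 c1 c2 where
    eqs: "N *\<^sub>v a = a1 \<cdot>\<^sub>v p + a2 \<cdot>\<^sub>v q" "N *\<^sub>v b = b1 \<cdot>\<^sub>v p + b2 \<cdot>\<^sub>v q" "N *\<^sub>v c = c1 \<cdot>\<^sub>v p + c2 \<cdot>\<^sub>v q"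
    using im abc by metis
  have comb: "\<alpha> \<cdot>\<^sub>v (N *\<^sub>v a) + \<beta> \<cdot>\<^sub>v (N *\<^sub>v b) + \<gamma> \<cdot>\<^sub>v (N *\<^sub>v c) = 0\<^sub>v d"
    if "\<alpha> * a1 + \<beta> * b1 + \<gamma> * c1 = 0" "\<alpha> * a2 + \<beta> * b2 + \<gamma> * c2 = 0" for \<alpha> \<beta> \<gamma>
  proof (rule eq_vecI)
    fix i assume "i < dim_vec (0\<^sub>v d :: complex vec)"
    then have i: "i < d" by simp
    have "(\<alpha> \<cdot>\<^sub>v (N *\<^sub>v a) + \<beta> \<cdot>\<^sub>v (N *\<^sub>v b) + \<gamma> \<cdot>\<^sub>v (N *\<^sub>v c)) $ i
        = (\<alpha> * a1 + \<beta> * b1 + \<gamma> * c1) * p $ i + (\<alpha> * a2 + \<beta> * b2 + \<gamma> * c2) * q $ i"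
      unfolding eqs using i p by (simp add: algebra_simps)
    then show "(\<alpha> \<cdot>\<^sub>v (N *\<^sub>v a) + \<beta> \<cdot>\<^sub>v (N *\<^sub>v b) + \<gamma> \<cdot>\<^sub>v (N *\<^sub>v c)) $ i = 0\<^sub>v d $ i"
      using that i by simp
  qed (use eqs p in simp)
  \<comment> \<open>The coefficients form the cross product of the two coordinate columns, so they
    give a relation, and independence makes this minor vanish. Then two-term relations between the
    images of \<open>a\<close> and \<open>b\<close> force \<open>a1\<close> and \<open>a2\<close> to
    vanish.\<close>
  have "a1 * b2 - a2 * b1 = 0"
    using li[OF comb[of "b1 * c2 - b2 * c1" "c1 * a2 - c2 * a1" "a1 * b2 - a2 * b1"]]
    by (simp add: algebra_simps)
  then have "a1 = 0" "a2 = 0"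
    using li[OF comb[of b1 "-a1" 0]] li[OF comb[of b2 "-a2" 0]] by (auto simp: algebra_simps)
  then show False using li[OF comb[of 1 0 0]] by simp
qed

text \<open>Two non-proportional columns would be an independent set of size 2. So all columns are
  multiples of one of them, and every image is a combination of columns.\<close>

lemma rank_le_1_line:
  assumes N: "N \<in> carrier_mat d d" and rank: "vec_space.rank d N \<le> 1"
  obtains p where "p \<in> carrier_vec d"
    "\<And>y. y \<in> carrier_vec d \<Longrightarrow> \<exists>c::complex. N *\<^sub>v y = c \<cdot>\<^sub>v p"
proof -
  interpret V: vec_space "TYPE(complex)" d .
  have colc: "col N j \<in> carrier_vec d" for j using N by auto
  obtain p where p: "p \<in> carrier_vec d" and cp: "\<And>j. j < d \<Longrightarrow> \<exists>c. col N j = c \<cdot>\<^sub>v p"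
  proof (cases "\<forall>j<d. col N j = 0\<^sub>v d")
    case True
    then have "col N j = 0 \<cdot>\<^sub>v 0\<^sub>v d" if "j < d" for j using that by auto
    then show ?thesis using that[of "0\<^sub>v d"] by blast
  next
    case False
    then obtain i where i: "i < d" "col N i \<noteq> 0\<^sub>v d" by blast
    have "\<exists>c. col N j = c \<cdot>\<^sub>v col N i" if j: "j < d" for j
    proof (rule ccontr)
      assume nc: "\<nexists>c. col N j = c \<cdot>\<^sub>v col N i"
      have "col N j \<noteq> 1 \<cdot>\<^sub>v col N i" using nc by blast
      then have ne: "col N j \<noteq> col N i" by simp
      let ?S = "{col N j, col N i}"
      have Sc: "?S \<subseteq> carrier_vec d" using colc by auto
      have "V.lin_indpt ?S"
      proof (rule V.finite_lin_indpt2)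
        fix f assume lz: "V.lincomb f ?S = 0\<^sub>v d"
        have e: "f (col N j) * col N j $ r + f (col N i) * col N i $ r = 0" if r: "r < d" for r
          using V.lincomb_index[OF r Sc, of f] lz ne r by simp
        have "f (col N j) = 0"
        proof (rule ccontr)
          assume nz: "f (col N j) \<noteq> 0"
          have "col N j = (- f (col N i) / f (col N j)) \<cdot>\<^sub>v col N i"
          proof (rule eq_vecI)
            fix r assume "r < dim_vec ((- f (col N i) / f (col N j)) \<cdot>\<^sub>v col N i)"
            then have r: "r < d" using N by simp
            then show "col N j $ r = ((- f (col N i) / f (col N j)) \<cdot>\<^sub>v col N i) $ r"
              using e[OF r] nz N by (simp add: field_simps add_eq_0_iff)
          qed simp
          then show False using nc by blast
        qed
        moreover have "f (col N i) = 0"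
        proof (rule ccontr)
          assume nz: "f (col N i) \<noteq> 0"
          have "col N i = 0\<^sub>v d"
          proof (rule eq_vecI)
            fix r assume "r < dim_vec (0\<^sub>v d :: complex vec)"
            then have r: "r < d" by simp
            then have "col N i $ r = 0" using e[OF r] nz \<open>f (col N j) = 0\<close> by simp
            then show "col N i $ r = 0\<^sub>v d $ r" using r by simp
          qed (use N in simp)
          then show False using i by simp
        qed
        ultimately show "\<forall>v\<in>?S. f v = 0" by simp
      qed (use Sc in auto)
      moreover have "?S \<subseteq> set (cols N)" using i j N by (auto simp: cols_def)
      ultimately have "card ?S \<le> vec_space.rank d N" using V.rank_ge_card_indpt[OF N] by blast
      then show False using ne rank by simp
    qed
    then show ?thesis using that colc by blast
  qed
  then obtain c where c: "\<And>j. j < d \<Longrightarrow> col N j = c j \<cdot>\<^sub>v p" by metis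
  show thesis
  proof (rule that[OF p])
    fix y :: "complex vec" assume y: "y \<in> carrier_vec d"
    have "N *\<^sub>v y = (\<Sum>j<d. c j * y $ j) \<cdot>\<^sub>v p"
    proof (rule eq_vecI)
      fix r assume "r < dim_vec ((\<Sum>j<d. c j * y $ j) \<cdot>\<^sub>v p)"
      then have r: "r < d" using p by simp
      have "(N *\<^sub>v y) $ r = (\<Sum>j<d. col N j $ r * y $ j)"
        using N y r by (auto simp: scalar_prod_def lessThan_atLeast0 intro!: sum.cong)
      also have "\<dots> = (\<Sum>j<d. c j * y $ j) * p $ r"
        using c p r by (auto simp: sum_distrib_right intro!: sum.cong)
      finally show "(N *\<^sub>v y) $ r = ((\<Sum>j<d. c j * y $ j) \<cdot>\<^sub>v p) $ r" using r p by simp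
    qed (use N p in simp)
    then show "\<exists>c. N *\<^sub>v y = c \<cdot>\<^sub>v p" by blast
  qed
qed

section \<open>Irreducible cyclic systems\<close>

text \<open>\<open>M j\<close> stands for B_j - x, with indices read modulo n+1 through
  \<open>period\<close>. The offsets in \<open>comm\<close> are those of the non-neighbours on a
  cycle of length n+1. \<open>irreducible\<close> mentions only \<open>M 0\<close>, ...,
  \<open>M (n-1)\<close>, which correspond to the n generators; subtracting a scalar does not change
  the invariant subspaces.\<close>

locale cyclic_irreducible =
  fixes n :: nat and T Ti :: "complex mat" and M :: "nat \<Rightarrow> complex mat"
  assumes n4: "n \<ge> 4"
    and T_carrier [simp]: "T \<in> carrier_mat (Suc n) (Suc n)"
    and Ti_carrier [simp]: "Ti \<in> carrier_mat (Suc n) (Suc n)"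
    and Ti_T: "Ti * T = 1\<^sub>m (Suc n)"
    and T_Ti: "T * Ti = 1\<^sub>m (Suc n)"
    and M_carrier [simp]: "M j \<in> carrier_mat (Suc n) (Suc n)"
    and shift: "T * M j = M (Suc j) * T"
    and period: "M (Suc (j + n)) = M j"
    and comm: "2 \<le> i \<Longrightarrow> i < n \<Longrightarrow> M k * M (k+i) = M (k+i) * M k"
    and irreducible: "cplx_subspace (Suc n) W \<Longrightarrow> (\<And>j w. j < n \<Longrightarrow> w \<in> W \<Longrightarrow> M j *\<^sub>v w \<in> W)
       \<Longrightarrow> W = {0\<^sub>v (Suc n)} \<or> W = carrier_vec (Suc n)"
begin

abbreviation "V \<equiv> (carrier_vec (Suc n) :: complex vec set)"
abbreviation "zv \<equiv> (0\<^sub>v (Suc n) :: complex vec)"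

lemma M_closed [simp]: "v \<in> V \<Longrightarrow> M j *\<^sub>v v \<in> V"
  using M_carrier by (rule mult_mat_vec_carrier)

lemma T_closed [simp]: "v \<in> V \<Longrightarrow> T *\<^sub>v v \<in> V"
  using T_carrier by (rule mult_mat_vec_carrier)

lemma Ti_closed [simp]: "v \<in> V \<Longrightarrow> Ti *\<^sub>v v \<in> V"
  using Ti_carrier by (rule mult_mat_vec_carrier)

lemma mult_zero [simp]: "N \<in> carrier_mat (Suc n) (Suc n) \<Longrightarrow> N *\<^sub>v zv = zv"
  by (intro eq_vecI) auto

lemma M_zero [simp]: "M j *\<^sub>v zv = zv" and T_zero [simp]: "T *\<^sub>v zv = zv" and Ti_zero [simp]: "Ti *\<^sub>v zv = zv"
  by simp_all

lemma smult_0_vec: "v \<in> V \<Longrightarrow> 0 \<cdot>\<^sub>v v = zv"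
  by (intro eq_vecI) auto

lemma smult_zv [simp]: "c \<cdot>\<^sub>v zv = zv"
  by (intro eq_vecI) auto

lemma smult_eq_zero:
  assumes "c \<cdot>\<^sub>v v = zv" "c \<noteq> 0"
  shows "v = zv"
proof -
  have "v = inverse c \<cdot>\<^sub>v (c \<cdot>\<^sub>v v)" using assms(2) by (simp add: smult_smult_assoc)
  also have "\<dots> = zv" unfolding assms(1) by simp
  finally show ?thesis .
qed

lemma M_add: "u \<in> V \<Longrightarrow> w \<in> V \<Longrightarrow> M j *\<^sub>v (u + w) = M j *\<^sub>v u + M j *\<^sub>v w"
  and M_smult: "u \<in> V \<Longrightarrow> M j *\<^sub>v (c \<cdot>\<^sub>v u) = c \<cdot>\<^sub>v (M j *\<^sub>v u)"
  and T_add: "u \<in> V \<Longrightarrow> w \<in> V \<Longrightarrow> T *\<^sub>v (u + w) = T *\<^sub>v u + T *\<^sub>v w"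
  and T_smult: "u \<in> V \<Longrightarrow> T *\<^sub>v (c \<cdot>\<^sub>v u) = c \<cdot>\<^sub>v (T *\<^sub>v u)"
  by (rule mult_add_distrib_mat_vec[OF M_carrier] mult_mat_vec[OF M_carrier]
      mult_add_distrib_mat_vec[OF T_carrier] mult_mat_vec[OF T_carrier]; assumption)+

lemma Ti_T_vec: "v \<in> V \<Longrightarrow> Ti *\<^sub>v (T *\<^sub>v v) = v"
  using assoc_mult_mat_vec[OF Ti_carrier T_carrier, of v] Ti_T by simp

lemma T_Ti_vec: "v \<in> V \<Longrightarrow> T *\<^sub>v (Ti *\<^sub>v v) = v"
  using assoc_mult_mat_vec[OF T_carrier Ti_carrier, of v] T_Ti by simp

lemma T_eq_zero: "v \<in> V \<Longrightarrow> T *\<^sub>v v = zv \<Longrightarrow> v = zv"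
  using Ti_T_vec[of v] by simp

lemma T_M: "v \<in> V \<Longrightarrow> T *\<^sub>v (M j *\<^sub>v v) = M (Suc j) *\<^sub>v (T *\<^sub>v v)"
  using assoc_mult_mat_vec[OF T_carrier M_carrier, of v j]
    assoc_mult_mat_vec[OF M_carrier T_carrier, of v "Suc j"] shift[of j] by simp

lemma M_comm: "2 \<le> i \<Longrightarrow> i < n \<Longrightarrow> v \<in> V \<Longrightarrow> M k *\<^sub>v (M (k+i) *\<^sub>v v) = M (k+i) *\<^sub>v (M k *\<^sub>v v)"
  using assoc_mult_mat_vec[OF M_carrier M_carrier, of v k "k+i"]
    assoc_mult_mat_vec[OF M_carrier M_carrier, of v "k+i" k] comm[of i k] by simp

lemma M_mod: "M (j mod (Suc n)) = M j"
proof -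
  have "M (a + b * (Suc n)) = M a" for a b
  proof (induction b)
    case (Suc b)
    have "a + Suc b * Suc n = Suc (a + b * Suc n + n)" by simp
    then show ?case using Suc period by metis
  qed simp
  from this[of "j mod Suc n" "j div Suc n"] show ?thesis unfolding mod_div_mult_eq by simp
qed

text \<open>Otherwise the line through \<open>v\<close> would be an invariant subspace of dimension
  1 in dimension n+1.\<close>

lemma no_common_eigenvector:
  assumes v: "v \<in> V" and eig: "\<And>j. j < n \<Longrightarrow> \<exists>c. M j *\<^sub>v v = c \<cdot>\<^sub>v v"
  shows "v = zv"
proof (rule ccontr)
  assume nz: "v \<noteq> zv"
  define W where "W = range (\<lambda>c. c \<cdot>\<^sub>v v)"
  have "cplx_subspace (Suc n) W"
    unfolding cplx_subspace_def W_def
  proof (intro conjI ballI allI)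
    show "range (\<lambda>c. c \<cdot>\<^sub>v v) \<subseteq> V" using v by auto
    have "zv = 0 \<cdot>\<^sub>v v" using v by (intro eq_vecI) auto
    then show "zv \<in> range (\<lambda>c. c \<cdot>\<^sub>v v)" by blast
    fix u w c assume u: "u \<in> range (\<lambda>c. c \<cdot>\<^sub>v v)"
    then obtain a where a: "u = a \<cdot>\<^sub>v v" by blast
    then have "c \<cdot>\<^sub>v u = (c * a) \<cdot>\<^sub>v v" by (simp add: smult_smult_assoc)
    then show "c \<cdot>\<^sub>v u \<in> range (\<lambda>c. c \<cdot>\<^sub>v v)" by blast
    assume "w \<in> range (\<lambda>c. c \<cdot>\<^sub>v v)"
    then obtain b where "w = b \<cdot>\<^sub>v v" by blast
    then have "u + w = (a + b) \<cdot>\<^sub>v v" using a by (simp add: add_smult_distrib_vec)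
    then show "u + w \<in> range (\<lambda>c. c \<cdot>\<^sub>v v)" by blast
  qed
  moreover have "M j *\<^sub>v w \<in> W" if j: "j < n" and w: "w \<in> W" for j w
  proof -
    obtain a where "w = a \<cdot>\<^sub>v v" using w W_def by blast
    moreover obtain c where "M j *\<^sub>v v = c \<cdot>\<^sub>v v" using eig[OF j] by blast
    ultimately have "M j *\<^sub>v w = (a * c) \<cdot>\<^sub>v v" using v by (simp add: M_smult smult_smult_assoc)
    then show ?thesis unfolding W_def by blast
  qed
  moreover have "v = 1 \<cdot>\<^sub>v v" by simp
  then have "v \<in> W" unfolding W_def by blast
  ultimately have "W = V" using irreducible[of W] nz by blast
  \<comment> \<open>A line that is the whole space would contain two different unit vectors.\<close>
  then obtain a b where a: "unit_vec (Suc n) 0 = a \<cdot>\<^sub>v v" and b: "unit_vec (Suc n) 1 = b \<cdot>\<^sub>v v"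
    unfolding W_def by (metis rangeE unit_vec_carrier)
  have "a * v $ 0 = 1" "a * v $ 1 = 0" "b * v $ 0 = 0" "b * v $ 1 = 1"
    using arg_cong[OF a, of "\<lambda>w. w $ 0"] arg_cong[OF a, of "\<lambda>w. w $ 1"]
      arg_cong[OF b, of "\<lambda>w. w $ 0"] arg_cong[OF b, of "\<lambda>w. w $ 1"] v n4 by auto
  then show False by (metis mult_eq_0_iff zero_neq_one)
qed

text \<open>Conjugation by \<open>T\<close> would carry the vanishing of one \<open>M j\<close> to
  all of them, and then every vector would be a common eigenvector.\<close>

lemma ex_M_nonzero: "\<exists>y\<in>V. M j *\<^sub>v y \<noteq> zv"
proof (rule ccontr)
  assume "\<not> ?thesis"
  then have z: "M j *\<^sub>v y = zv" if "y \<in> V" for y using that by blast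
  have up: "\<forall>y\<in>V. M (j + k) *\<^sub>v y = zv" for k
  proof (induction k)
    case (Suc k)
    show ?case
    proof
      fix y assume "y \<in> V"
      then show "M (j + Suc k) *\<^sub>v y = zv"
        using Suc T_M[of "Ti *\<^sub>v y" "j+k"] by (simp add: T_Ti_vec)
    qed
  qed (use z in simp)
  have all: "M i *\<^sub>v y = zv" if "y \<in> V" for i y
  proof -
    \<comment> \<open>The index equals i + j(n+1), so climbing from \<open>j\<close> reaches every
      residue.\<close>
    have "M (j + (i + j * n)) *\<^sub>v y = zv" using up that by blast
    moreover have "M (j + (i + j * n)) = M i"
    proof -
      have "j + (i + j * n) = i + j * Suc n" by simp
      then have "(j + (i + j * n)) mod Suc n = (i + j * Suc n) mod Suc n" by (rule arg_cong)
      also have "\<dots> = i mod (Suc n)" by (rule mod_mult_self1)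
      finally show ?thesis using M_mod by metis
    qed
    ultimately show ?thesis by simp
  qed
  have "unit_vec (Suc n) 0 = zv"
  proof (rule no_common_eigenvector)
    fix j
    have "M j *\<^sub>v unit_vec (Suc n) 0 = 0 \<cdot>\<^sub>v unit_vec (Suc n) 0"
      using all by (intro eq_vecI) auto
    then show "\<exists>c. M j *\<^sub>v unit_vec (Suc n) 0 = c \<cdot>\<^sub>v unit_vec (Suc n) 0" by blast
  qed simp
  then show False by simp
qed

section \<open>Cyclic distance and common kernels\<close>

text \<open>Distance at least 2 on the cycle of length n+1, for indices that differ by less than
  \<open>n\<close>. Between 0 and \<open>n\<close> no other pairs have that distance, since a
  difference of \<open>n\<close> means neighbours across the wrap.\<close>

definition far :: "nat \<Rightarrow> nat \<Rightarrow> bool" where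
  "far j k \<longleftrightarrow> (k + 2 \<le> j \<and> j < k + n) \<or> (j + 2 \<le> k \<and> k < j + n)"

lemma M_comm_far:
  assumes "far j k" "v \<in> V"
  shows "M j *\<^sub>v (M k *\<^sub>v v) = M k *\<^sub>v (M j *\<^sub>v v)"
proof (cases "k \<le> j")
  case True
  then show ?thesis using M_comm[of "j - k" v k] assms by (auto simp: far_def)
next
  case False
  then show ?thesis using M_comm[of "k - j" v j] assms by (auto simp: far_def)
qed

text \<open>The missing offsets 0, 1 and \<open>n\<close> are the cyclic neighbours of \<open>k\<close>, since
  \<open>k + n\<close> stands for \<open>k - 1\<close>.\<close>
definition E :: "nat \<Rightarrow> complex vec set" where
  "E k = {v \<in> V. \<forall>i\<in>{2..<n}. M (k + i) *\<^sub>v v = zv}"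

lemma E_closed: "v \<in> E k \<Longrightarrow> v \<in> V"
  by (simp add: E_def)

lemma E_subspace: "cplx_subspace (Suc n) (E k)"
  by (auto simp: cplx_subspace_def E_def M_add M_smult)

lemma E_far:
  assumes v: "v \<in> E k" and "far j k"
  shows "M j *\<^sub>v v = zv"
proof (cases "k \<le> j")
  case True
  then have "j - k \<in> {2..<n}" using assms(2) by (auto simp: far_def)
  then have "M (k + (j - k)) *\<^sub>v v = zv" using v unfolding E_def by blast
  then show ?thesis using True by simp
next
  case False
  \<comment> \<open>Here j < k, so a full period is added to \<open>j\<close> to obtain an offset
    above \<open>k\<close>.\<close>
  then have "Suc (j + n) - k \<in> {2..<n}" "k + (Suc (j + n) - k) = Suc (j + n)"
    using assms(2) by (auto simp: far_def)
  moreover have "\<forall>i\<in>{2..<n}. M (k + i) *\<^sub>v v = zv" using v by (simp add: E_def)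
  ultimately have "M (Suc (j + n)) *\<^sub>v v = zv" by metis
  then show ?thesis using period by simp
qed

lemma T_E: "v \<in> E k \<Longrightarrow> T *\<^sub>v v \<in> E (Suc k)"
  by (auto simp: E_def T_M[symmetric])

lemma E_mod: "E (k mod Suc n) = E k"
proof -
  have "M (k mod Suc n + i) = M (k + i)" for i
    by (metis M_mod mod_add_left_eq)
  then show ?thesis by (simp add: E_def)
qed

section \<open>Powers of the rotation\<close>

definition Tp :: "nat \<Rightarrow> complex vec \<Rightarrow> complex vec" where
  "Tp m = (\<lambda>v. T *\<^sub>v v) ^^ m"

lemma Tp_0 [simp]: "Tp 0 v = v" and Tp_Suc [simp]: "Tp (Suc m) v = T *\<^sub>v Tp m v"
  by (simp_all add: Tp_def)

lemma Tp_closed [simp]: "v \<in> V \<Longrightarrow> Tp m v \<in> V"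
  by (induction m) auto

lemma Tp_zero [simp]: "Tp m zv = zv"
  by (induction m) auto

lemma Tp_smult: "v \<in> V \<Longrightarrow> Tp m (c \<cdot>\<^sub>v v) = c \<cdot>\<^sub>v Tp m v"
  by (induction m) (auto simp: T_smult)

lemma Tp_eq_zero: "v \<in> V \<Longrightarrow> Tp m v = zv \<Longrightarrow> v = zv"
  by (induction m) (auto dest: T_eq_zero[rotated])

lemma Tp_surj: "y \<in> V \<Longrightarrow> \<exists>v\<in>V. Tp m v = y"
proof (induction m arbitrary: y)
  case (Suc m)
  then obtain v where "v \<in> V" "Tp m v = Ti *\<^sub>v y" by (meson Ti_closed)
  then have "Tp (Suc m) v = y" using Suc.prems T_Ti_vec by simp
  then show ?case using \<open>v \<in> V\<close> by blast
qed auto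

lemma M_Tp: "v \<in> V \<Longrightarrow> M (j + m) *\<^sub>v Tp m v = Tp m (M j *\<^sub>v v)"
  by (induction m) (auto simp: T_M[symmetric])

lemma Tp_E: "v \<in> E k \<Longrightarrow> Tp m v \<in> E (k + m)"
  by (induction m) (auto dest: T_E)

section \<open>Lower bound for the rank\<close>

text \<open>If the image of \<open>M 0\<close> lies on the line of \<open>p\<close>, that of
  \<open>M j\<close> lies on the line of T^j p. For j < n these are n vectors in dimension n+1, so
  some hyperplane contains all these images and is therefore invariant.\<close>

lemma rank_ge_2: "2 \<le> vec_space.rank (Suc n) (M 0)"
proof (rule ccontr)
  assume "\<not> 2 \<le> vec_space.rank (Suc n) (M 0)"
  then have "vec_space.rank (Suc n) (M 0) \<le> 1" by simp
  from rank_le_1_line[OF M_carrier this] obtain p where p: "p \<in> V"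
    and im: "\<And>y. y \<in> V \<Longrightarrow> \<exists>c. M 0 *\<^sub>v y = c \<cdot>\<^sub>v p" by blast
  \<comment> \<open>The zero vector at index \<open>n\<close> completes the square matrix and makes
    it singular.\<close>
  define u where "u k = (if k < n then Tp k p else zv)" for k
  let ?P = "col_mat (Suc n) u"
  have uV: "u k \<in> V" for k using p by (simp add: u_def)
  have "?P *\<^sub>v unit_vec (Suc n) n = zv"
    by (subst mult_mat_unit_vec) (auto intro!: eq_vecI simp: col_mat_def u_def)
  then have "det ?P = 0"
    using det_0_iff_vec_prod_zero[OF col_mat_carrier] unit_vec_carrier unit_vec_nonzero
    by (metis lessI)
  \<comment> \<open>A kernel vector \<open>w\<close> of the transpose is orthogonal to every
    \<open>u k\<close> for the bilinear product, without complex conjugation.\<close>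
  then have "det (transpose_mat ?P) = 0" by (simp add: det_transpose[OF col_mat_carrier])
  then obtain w where w: "w \<in> V" "w \<noteq> zv" "transpose_mat ?P *\<^sub>v w = zv"
    using det_0_iff_vec_prod_zero[of "transpose_mat ?P" "Suc n"] by auto
  have wu: "u k \<bullet> w = 0" if "k < n" for k
  proof -
    have "col ?P k = u k" using that uV[of k] by (intro eq_vecI) (auto simp: col_mat_def)
    then have "(transpose_mat ?P *\<^sub>v w) $ k = u k \<bullet> w" using that by simp
    then show ?thesis using w that by simp
  qed
  define W where "W = {y \<in> V. y \<bullet> w = 0}"
  have "cplx_subspace (Suc n) W"
    using w by (auto simp: cplx_subspace_def W_def add_scalar_prod_distrib[of _ "Suc n"])
  moreover have "M j *\<^sub>v y \<in> W" if j: "j < n" and y: "y \<in> W" for j y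
  proof -
    \<comment> \<open>With y = T^j v, the vector M_j y is T^j applied to M_0 v, hence a multiple of
      T^j p.\<close>
    obtain v where v: "v \<in> V" "Tp j v = y" using Tp_surj y W_def by blast
    obtain c where "M 0 *\<^sub>v v = c \<cdot>\<^sub>v p" using im v by blast
    then have "M j *\<^sub>v y = c \<cdot>\<^sub>v u j" using M_Tp[of v 0 j] v p j by (simp add: Tp_smult u_def)
    then show ?thesis using wu[OF j] uV w by (simp add: W_def)
  qed
  ultimately have "W = {zv} \<or> W = V" by (rule irreducible)
  moreover have "W \<noteq> {zv}"
  proof
    assume "W = {zv}"
    moreover have "u 0 = p" using n4 by (simp add: u_def)
    then have "p \<in> W" using wu[of 0] n4 p by (simp add: W_def)
    ultimately have "p = zv" by simp
    then have "M 0 *\<^sub>v y = zv" if "y \<in> V" for y using im[OF that] by auto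
    then show False using ex_M_nonzero by blast
  qed
  moreover have "W \<noteq> V"
  proof
    assume "W = V"
    then have "unit_vec (Suc n) i \<bullet> w = 0" for i using unit_vec_carrier[of "Suc n" i] W_def by blast
    then have "w $ i = 0" if "i < Suc n" for i using scalar_prod_left_unit[OF w(1) that] by simp
    then have "w = zv" using w by (intro eq_vecI) auto
    then show False using w by simp
  qed
  ultimately show False by blast
qed

section \<open>First case: products of neighbours vanish on the kernels\<close>

text \<open>If \<open>k\<close> is far from \<open>i\<close>, the image is zero; if they agree
  modulo n+1, commutation suffices. If they are neighbours, commutation and \<open>E_far\<close>
  settle every offset but one, and that one is \<open>H\<close>, where \<open>k + n\<close> stands
  for k-1.\<close>

lemma E_M_closed:
  assumes H: "\<And>k v. v \<in> E k \<Longrightarrow> M (k + 1) *\<^sub>v (M (k + n) *\<^sub>v v) = zv" and v: "v \<in> E i"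
  shows "M k *\<^sub>v v \<in> E k"
proof -
  have vV: "v \<in> V" using v by (rule E_closed)
  have red: "M k *\<^sub>v v \<in> E k" if "M l *\<^sub>v v \<in> E l" "l mod Suc n = k mod Suc n" for l k
    using that by (metis E_mod M_mod)
  have same: "M i *\<^sub>v v \<in> E i"
    using v M_comm[OF _ _ vV, of _ i, symmetric] by (simp add: E_def)
  have right: "M (i + 1) *\<^sub>v v \<in> E (i + 1)"
    unfolding E_def
  proof (intro CollectI conjI ballI)
    fix j assume j: "j \<in> {2..<n}"
    have "M (i + 1 + j) *\<^sub>v (M (i + 1) *\<^sub>v v) = M (i + 1) *\<^sub>v (M (i + 1 + j) *\<^sub>v v)"
      using M_comm[OF _ _ vV, of j "i + 1"] j by simp
    also have "\<dots> = zv"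
    \<comment> \<open>The offset n-1 from i+1 leads to i+n, the left neighbour of \<open>i\<close>;
      the other indices are far from \<open>i\<close>.\<close>
    proof (cases "j = n - 1")
      case True
      then show ?thesis using H[OF v] n4 by simp
    next
      case False
      then have "far (i + 1 + j) i" using j by (auto simp: far_def)
      then show ?thesis using E_far[OF v] by simp
    qed
    finally show "M (i + 1 + j) *\<^sub>v (M (i + 1) *\<^sub>v v) = zv" .
  qed (use vV in simp)
  have left: "M (i + n) *\<^sub>v v \<in> E (i + n)"
    unfolding E_def
  proof (intro CollectI conjI ballI)
    fix j assume j: "j \<in> {2..<n}"
    have per: "M (i + n + j) = M (i + (j - 1))"
      using period[of "i + (j - 1)"] j by (simp add: ac_simps)
    have "M (i + n + j) *\<^sub>v (M (i + n) *\<^sub>v v) = M (i + n) *\<^sub>v (M (i + (j - 1)) *\<^sub>v v)"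
      using M_comm[OF _ _ vV, of j "i + n"] j per by simp
    also have "\<dots> = zv"
    \<comment> \<open>The offset 2 from i-1 leads to the right neighbour of \<open>i\<close>. The
      two factors in \<open>H\<close> commute, so their order does not matter.\<close>
    proof (cases "j = 2")
      case True
      have "far (i + n) (i + 1)" using n4 by (auto simp: far_def)
      then show ?thesis using H[OF v] True M_comm_far[OF _ vV] by simp
    next
      case False
      then have "far (i + (j - 1)) i" using j by (auto simp: far_def)
      then show ?thesis using E_far[OF v] by simp
    qed
    finally show "M (i + n + j) *\<^sub>v (M (i + n) *\<^sub>v v) = zv" .
  qed (use vV in simp)
  \<comment> \<open>Among residues, \<open>k'\<close> is far from, equal to or next to
    \<open>i'\<close>; the wrap between 0 and \<open>n\<close> accounts for two extra cases.\<close>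
  define i' k' where "i' = i mod Suc n" and "k' = k mod Suc n"
  have le: "i' \<le> n" "k' \<le> n" by (simp_all add: i'_def k'_def less_Suc_eq_le[symmetric])
  have v': "v \<in> E i'" using v by (simp add: i'_def E_mod)
  consider "far k' i'" | "k' = i'" | "k' = i' + 1" | "k' = 0" "i' = n" | "i' = k' + 1" | "k' = n" "i' = 0"
    using le unfolding far_def by linarith
  then show ?thesis
  proof cases
    case 1
    then have "M k' *\<^sub>v v = zv" using E_far[OF v'] by simp
    then have "M k *\<^sub>v v = zv" by (simp add: k'_def M_mod)
    then show ?thesis using E_subspace[of k] by (simp add: cplx_subspace_def)
  next
    case 2
    then show ?thesis using red[OF same, of k] by (simp add: i'_def k'_def)
  next
    case 3
    then have "(i + 1) mod Suc n = k mod Suc n"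
      using le unfolding i'_def k'_def by (metis Suc_eq_plus1 le_imp_less_Suc mod_Suc_eq mod_less)
    then show ?thesis using red[OF right, of k] by simp
  next
    case 4
    then have "(i + 1) mod Suc n = k mod Suc n"
      unfolding i'_def k'_def by (simp add: mod_Suc)
    then show ?thesis using red[OF right, of k] by simp
  next
    case 5
    then have "(i + n) mod Suc n = (k' + 1 + n) mod Suc n"
      unfolding i'_def by (metis mod_add_left_eq)
    also have "\<dots> = k mod Suc n" using mod_add_self2[of k' "Suc n"] by (simp add: k'_def)
    finally show ?thesis using red[OF left, of k] by simp
  next
    case 6
    then have "(i + n) mod Suc n = k mod Suc n"
      unfolding i'_def k'_def by (metis add.left_neutral lessI mod_add_left_eq mod_less)
    then show ?thesis using red[OF left, of k] by simp
  qed
qed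

text \<open>The set \<open>X\<close> contains every \<open>E i\<close> by \<open>E_M_closed\<close>.
  It is invariant because \<open>M j\<close> sends \<open>X\<close> into \<open>E j\<close>, hence
  back into \<open>X\<close>. As \<open>v\<close> lies in \<open>X\<close>, irreducibility makes it
  everything.\<close>

lemma image_subset_E:
  assumes H: "\<And>k v. v \<in> E k \<Longrightarrow> M (k + 1) *\<^sub>v (M (k + n) *\<^sub>v v) = zv"
    and ne: "v \<in> E 0" "v \<noteq> zv" and y: "y \<in> V"
  shows "M k *\<^sub>v y \<in> E k"
proof -
  define X where "X = {y \<in> V. \<forall>k. M k *\<^sub>v y \<in> E k}"
  have EX: "w \<in> X" if "w \<in> E i" for w i
    using E_M_closed[OF H that] E_closed[OF that] by (simp add: X_def)
  have "cplx_subspace (Suc n) X"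
    using E_subspace by (auto simp: cplx_subspace_def X_def M_add M_smult)
  moreover have "M j *\<^sub>v w \<in> X" if "w \<in> X" for j w
    using that EX[of "M j *\<^sub>v w" j] by (simp add: X_def)
  ultimately have "X = {zv} \<or> X = V" by (intro irreducible)
  then have "X = V" using EX[OF ne(1)] ne(2) by blast
  then show ?thesis using y X_def by blast
qed

text \<open>\<open>E 0\<close> is killed by the operators with indices 2 to n-1, \<open>E 2\<close>
  by those with indices 4 to n+1. As n \<ge> 4, together these are the n consecutive indices 2 to
  n+1, and T^(n-1) rotates them to 0, ..., n-1, where irreducibility applies.\<close>

lemma E_0_Int_E_2:
  assumes "y \<in> E 0" "y \<in> E 2"
  shows "y = zv"
proof -
  have yV: "y \<in> V" using assms E_closed by blast
  have kill: "M (j + 2) *\<^sub>v y = zv" if j: "j < n" for j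
  proof -
    consider "j + 2 < n" | "j + 2 = n" | "j + 2 = Suc n" using j by linarith
    then show ?thesis
    proof cases
      case 1
      then show ?thesis using E_far[OF assms(1), of "j + 2"] by (simp add: far_def)
    next
      case 2
      then show ?thesis using E_far[OF assms(2), of "j + 2"] n4 by (simp add: far_def)
    next
      case 3
      then have "far (j + 2) 2" using n4 by (auto simp: far_def)
      then show ?thesis using E_far[OF assms(2)] by blast
    qed
  qed
  have "Tp (n - 1) y = zv"
  proof (rule no_common_eigenvector)
    fix j assume j: "j < n"
    have "j + 2 + (n - 1) = Suc (j + n)" using n4 by simp
    then have "M j *\<^sub>v Tp (n - 1) y = zv"
      using M_Tp[OF yV, of "j + 2" "n - 1"] kill[OF j] period[of j] by simp
    also have "zv = 0 \<cdot>\<^sub>v Tp (n - 1) y" using smult_0_vec[OF Tp_closed[OF yV]] by simp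
    finally show "\<exists>c. M j *\<^sub>v Tp (n - 1) y = c \<cdot>\<^sub>v Tp (n - 1) y" by blast
  qed (use yV in simp)
  then show ?thesis using Tp_eq_zero yV by blast
qed

section \<open>Growth of the sums of images\<close>

text \<open>The space I_0 + ... + I_{m-1}, where I_k is the image of \<open>M k\<close>.\<close>

primrec image_sum :: "nat \<Rightarrow> complex vec set" where
  "image_sum 0 = {zv}"
| "image_sum (Suc m) = {a + M m *\<^sub>v b | a b. a \<in> image_sum m \<and> b \<in> V}"

lemma image_sum_SucI: "a \<in> image_sum m \<Longrightarrow> b \<in> V \<Longrightarrow> a + M m *\<^sub>v b \<in> image_sum (Suc m)"
  by auto

lemma image_sum_subspace: "cplx_subspace (Suc n) (image_sum m)"
proof (induction m)
  case (Suc m)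
  then have c: "image_sum m \<subseteq> V" and z: "zv \<in> image_sum m"
    and a: "\<And>u w. u \<in> image_sum m \<Longrightarrow> w \<in> image_sum m \<Longrightarrow> u + w \<in> image_sum m"
    and s: "\<And>c w. w \<in> image_sum m \<Longrightarrow> c \<cdot>\<^sub>v w \<in> image_sum m"
    by (auto simp: cplx_subspace_def)
  show ?case
    unfolding cplx_subspace_def
  proof (intro conjI ballI allI)
    show "image_sum (Suc m) \<subseteq> V" using c by auto
    show "zv \<in> image_sum (Suc m)" using image_sum_SucI[OF z zero_carrier_vec] by simp
    fix u w d
    assume "u \<in> image_sum (Suc m)"
    then obtain p b where u: "u = p + M m *\<^sub>v b" "p \<in> image_sum m" "b \<in> V" by auto
    have pV: "p \<in> V" using u c by auto
    have "d \<cdot>\<^sub>v u = d \<cdot>\<^sub>v p + M m *\<^sub>v (d \<cdot>\<^sub>v b)"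
      unfolding u(1) M_smult[OF u(3)] using smult_add_distrib_vec[OF pV, of "M m *\<^sub>v b"] u by simp
    moreover have "d \<cdot>\<^sub>v b \<in> V" "d \<cdot>\<^sub>v p \<in> image_sum m" using u s by auto
    ultimately show "d \<cdot>\<^sub>v u \<in> image_sum (Suc m)" using image_sum_SucI by metis
    assume "w \<in> image_sum (Suc m)"
    then obtain q e where w: "w = q + M m *\<^sub>v e" "q \<in> image_sum m" "e \<in> V" by auto
    have qV: "q \<in> V" using w c by auto
    have "u + w = (p + q) + M m *\<^sub>v (b + e)"
      unfolding u(1) w(1) M_add[OF u(3) w(3)]
      using pV qV M_closed[OF u(3), of m] M_closed[OF w(3), of m]
      by (intro eq_vecI) auto
    moreover have "b + e \<in> V" "p + q \<in> image_sum m" using u w a by auto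
    ultimately show "u + w \<in> image_sum (Suc m)" using image_sum_SucI by metis
  qed
qed (auto simp: cplx_subspace_def)

lemma image_sum_closed: "a \<in> image_sum m \<Longrightarrow> a \<in> V"
  using image_sum_subspace[of m] by (auto simp: cplx_subspace_def)

lemma image_sum_mono_Suc: "image_sum m \<subseteq> image_sum (Suc m)"
proof
  fix a assume a: "a \<in> image_sum m"
  then show "a \<in> image_sum (Suc m)"
    using image_sum_SucI[OF a zero_carrier_vec] image_sum_closed[OF a] by simp
qed

lemma image_sum_mono: "k \<le> m \<Longrightarrow> image_sum k \<subseteq> image_sum m"
  by (rule lift_Suc_mono_le[of image_sum]) (use image_sum_mono_Suc in auto)

lemma image_in_image_sum:
  assumes "k < m" "b \<in> V" shows "M k *\<^sub>v b \<in> image_sum m"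
proof -
  have "zv \<in> image_sum k" using image_sum_subspace by (simp add: cplx_subspace_def)
  then have "zv + M k *\<^sub>v b \<in> image_sum (Suc k)" using assms(2) by (rule image_sum_SucI)
  then have "M k *\<^sub>v b \<in> image_sum (Suc k)" using assms by (simp del: image_sum.simps)
  then show ?thesis using image_sum_mono[of "Suc k" m] assms by auto
qed

lemma T_image_sum: "a \<in> image_sum m \<Longrightarrow> T *\<^sub>v a \<in> image_sum (Suc m)"
proof (induction m arbitrary: a)
  case 0
  then show ?case using image_sum_subspace[of "Suc 0"] by (simp add: cplx_subspace_def)
next
  case (Suc m)
  then obtain p b where a: "a = p + M m *\<^sub>v b" "p \<in> image_sum m" "b \<in> V" by auto
  have "T *\<^sub>v a = T *\<^sub>v p + M (Suc m) *\<^sub>v (T *\<^sub>v b)"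
    using a image_sum_closed[OF a(2)] by (simp add: T_add T_M)
  moreover have "T *\<^sub>v p \<in> image_sum (Suc m)" "T *\<^sub>v b \<in> V" using Suc.IH a by auto
  ultimately show ?case unfolding image_sum.simps(2)[of "Suc m"] by blast
qed

text \<open>If the sum stopped growing, \<open>T\<close> would map it into itself, so it would
  contain every image and be the whole space. But \<open>M (n-1)\<close> kills it while being
  nonzero.\<close>

lemma image_sum_strict:
  assumes H: "\<And>k y. y \<in> V \<Longrightarrow> M k *\<^sub>v y \<in> E k" and m: "0 < m" "m + 2 \<le> n"
  shows "\<exists>b\<in>V. M m *\<^sub>v b \<notin> image_sum m"
proof (rule ccontr)
  assume "\<not> ?thesis"
  then have sub: "M m *\<^sub>v b \<in> image_sum m" if "b \<in> V" for b using that by blast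
  have add: "u + w \<in> image_sum m" if "u \<in> image_sum m" "w \<in> image_sum m" for u w
    using that image_sum_subspace[of m] by (auto simp: cplx_subspace_def)
  have "image_sum (Suc m) \<subseteq> image_sum m" using sub add by auto
  then have Tinv: "T *\<^sub>v a \<in> image_sum m" if "a \<in> image_sum m" for a using T_image_sum that by blast
  have up: "\<forall>b\<in>V. M (m + i) *\<^sub>v b \<in> image_sum m" for i
  proof (induction i)
    case (Suc i)
    show ?case
    proof
      fix b assume b: "b \<in> V"
      then have "M (m + Suc i) *\<^sub>v b = T *\<^sub>v (M (m + i) *\<^sub>v (Ti *\<^sub>v b))" by (simp add: T_M T_Ti_vec)
      then show "M (m + Suc i) *\<^sub>v b \<in> image_sum m" using Suc Tinv b by simp
    qed
  qed (use sub in simp)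
  have all: "M k *\<^sub>v b \<in> image_sum m" if "b \<in> V" for k b
  proof (cases "k < m")
    case True
    then show ?thesis using image_in_image_sum that by blast
  next
    case False
    then show ?thesis using up[of "k - m"] that by simp
  qed
  have "image_sum m = {zv} \<or> image_sum m = V"
    by (rule irreducible[OF image_sum_subspace]) (use all image_sum_closed in blast)
  moreover obtain b where "b \<in> V" "M 0 *\<^sub>v b \<noteq> zv" using ex_M_nonzero by blast
  then have "image_sum m \<noteq> {zv}" using all[of b 0] by auto
  \<comment> \<open>For k \<le> n-2 the index n-1 is far from 0, ..., k-1, and each image I_i lies
    in \<open>E i\<close>.\<close>
  moreover have kill: "M (n - 1) *\<^sub>v a = zv" if "a \<in> image_sum k" "k + 2 \<le> n" for a k
    using that
  proof (induction k arbitrary: a)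
    case (Suc k)
    then obtain p b where a: "a = p + M k *\<^sub>v b" "p \<in> image_sum k" "b \<in> V" by auto
    have "far (n - 1) k" using Suc.prems by (auto simp: far_def)
    then have "M (n - 1) *\<^sub>v (M k *\<^sub>v b) = zv" using E_far[OF H[OF a(3)]] by blast
    then show ?case using Suc a image_sum_closed[OF a(2)] by (simp add: M_add)
  qed auto
  have "image_sum m \<noteq> V"
  proof
    assume "image_sum m = V"
    then have "M (n - 1) *\<^sub>v a = zv" if "a \<in> V" for a using kill that m by blast
    then show False using ex_M_nonzero by blast
  qed
  ultimately show False by blast
qed

text \<open>Rank 3 would give three dimensions in I_0, three more from I_2, and one more for each
  further image up to index n-2: in total n+2 in a space of dimension n+1.\<close>

lemma rank_le_2_if_image_subset_E:
  assumes H: "\<And>k y. y \<in> V \<Longrightarrow> M k *\<^sub>v y \<in> E k"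
  shows "vec_space.rank (Suc n) (M 0) \<le> 2"
proof (rule ccontr)
  assume "\<not> vec_space.rank (Suc n) (M 0) \<le> 2"
  then have "vec_space.rank (Suc n) (M 0) \<ge> 3" by simp
  from rank_ge_3_independent[OF M_carrier this] obtain a b c where
    abc: "a \<in> V" "b \<in> V" "c \<in> V"
    and li: "\<And>\<alpha> \<beta> \<gamma> :: complex. \<alpha> \<cdot>\<^sub>v (M 0 *\<^sub>v a) + \<beta> \<cdot>\<^sub>v (M 0 *\<^sub>v b) + \<gamma> \<cdot>\<^sub>v (M 0 *\<^sub>v c) = zv
       \<Longrightarrow> \<alpha> = 0 \<and> \<beta> = 0 \<and> \<gamma> = 0" by metis
  have "has_independent (Suc n) (0 + 3) (image_sum 1)"
  proof (rule has_independent_add3[OF has_independent_0])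
    show "cplx_subspace (Suc n) {zv}" using image_sum_subspace[of 0] by simp
    show "{zv} \<subseteq> image_sum 1" using image_sum_mono[of 0 1] by simp
    show "M 0 *\<^sub>v a \<in> image_sum 1" "M 0 *\<^sub>v b \<in> image_sum 1" "M 0 *\<^sub>v c \<in> image_sum 1"
      using abc by (auto intro!: image_in_image_sum simp del: One_nat_def)
    fix \<alpha> \<beta> \<gamma>
    assume "\<alpha> \<cdot>\<^sub>v (M 0 *\<^sub>v a) + \<beta> \<cdot>\<^sub>v (M 0 *\<^sub>v b) + \<gamma> \<cdot>\<^sub>v (M 0 *\<^sub>v c) \<in> {zv}"
    then show "\<alpha> = 0 \<and> \<beta> = 0 \<and> \<gamma> = 0" using li by blast
  qed (rule image_sum_subspace)
  then have ind3: "has_independent (Suc n) 3 (image_sum 1)" by simp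
  \<comment> \<open>T^2 carries I_0 into I_2. A combination that falls back into I_0 lies in both
    \<open>E 0\<close> and \<open>E 2\<close>, so it is zero, and the independence in I_0
    applies.\<close>
  have "has_independent (Suc n) (3 + 3) (image_sum 3)"
  proof (rule has_independent_add3[OF ind3])
    let ?TT = "\<lambda>v. T *\<^sub>v (T *\<^sub>v v)"
    have TT: "?TT (M 0 *\<^sub>v v) = M 2 *\<^sub>v ?TT v" if "v \<in> V" for v
      using that by (simp add: T_M numeral_2_eq_2)
    show "?TT (M 0 *\<^sub>v a) \<in> image_sum 3" "?TT (M 0 *\<^sub>v b) \<in> image_sum 3" "?TT (M 0 *\<^sub>v c) \<in> image_sum 3"
      using abc TT image_in_image_sum[of 2 3] by auto
    fix \<alpha> \<beta> \<gamma> :: complex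
    let ?y = "\<alpha> \<cdot>\<^sub>v a + \<beta> \<cdot>\<^sub>v b + \<gamma> \<cdot>\<^sub>v c"
    let ?w = "\<alpha> \<cdot>\<^sub>v ?TT (M 0 *\<^sub>v a) + \<beta> \<cdot>\<^sub>v ?TT (M 0 *\<^sub>v b) + \<gamma> \<cdot>\<^sub>v ?TT (M 0 *\<^sub>v c)"
    assume w: "?w \<in> image_sum 1"
    then obtain e where e: "e \<in> V" "?w = zv + M 0 *\<^sub>v e" by auto
    then have "?w \<in> E 0" using H[OF e(1), of 0] by simp
    have M0y: "M 0 *\<^sub>v ?y = \<alpha> \<cdot>\<^sub>v (M 0 *\<^sub>v a) + \<beta> \<cdot>\<^sub>v (M 0 *\<^sub>v b) + \<gamma> \<cdot>\<^sub>v (M 0 *\<^sub>v c)"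
      using abc by (simp add: M_add M_smult del: assoc_add_vec)
    have wy: "?w = ?TT (M 0 *\<^sub>v ?y)"
      unfolding M0y using abc by (simp add: T_add T_smult del: assoc_add_vec)
    also have "\<dots> = M 2 *\<^sub>v ?TT ?y" using abc by (intro TT) auto
    also have "\<dots> \<in> E 2" using abc by (intro H) auto
    finally have "?w = zv" using \<open>?w \<in> E 0\<close> E_0_Int_E_2 by blast
    then have "M 0 *\<^sub>v ?y = zv" unfolding wy using abc T_eq_zero by simp
    then show "\<alpha> = 0 \<and> \<beta> = 0 \<and> \<gamma> = 0" using li M0y by simp
  qed (rule image_sum_subspace image_sum_mono; simp)+
  then have ind6: "has_independent (Suc n) 6 (image_sum 3)" by simp
  have "has_independent (Suc n) (6 + k) (image_sum (3 + k))" if "k + 4 \<le> n" for k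
    using that
  proof (induction k)
    case (Suc k)
    obtain b where b: "b \<in> V" "M (3 + k) *\<^sub>v b \<notin> image_sum (3 + k)"
      using image_sum_strict[OF H, of "3 + k"] Suc.prems by auto
    have "has_independent (Suc n) (Suc (6 + k)) (image_sum (Suc (3 + k)))"
      by (rule has_independent_Suc[OF _ image_sum_subspace image_sum_mono_Suc _ b(2)])
        (use Suc b image_in_image_sum[of "3 + k" "Suc (3 + k)"] in auto)
    then show ?case by simp
  qed (use ind6 in simp)
  \<comment> \<open>The largest admissible \<open>k\<close> reaches \<open>image_sum (n-1)\<close>,
    with n+2 independent vectors.\<close>
  from this[of "n - 4"] n4 have "has_independent (Suc n) (6 + (n - 4)) (image_sum (3 + (n - 4)))" by simp
  then have "6 + (n - 4) \<le> Suc n" by (rule has_independent_le) (use image_sum_closed in blast)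
  then show False using n4 by simp
qed

section \<open>Second case: a basis permuted by the rotation\<close>

text \<open>The product of the two neighbours of \<open>M i\<close> kills \<open>u k\<close> for k
  \<noteq> i but not \<open>u i\<close>, so it reads off the coordinate \<open>i\<close> and shows
  that \<open>u 0\<close>, ..., \<open>u n\<close> form a basis. In this basis \<open>M 0\<close>
  either has an evidently small image or leads to a common eigenvector.\<close>

lemma rank_le_2_if_not_E_M_closed:
  assumes u0: "u0 \<in> E 0" and nz: "M 1 *\<^sub>v (M n *\<^sub>v u0) \<noteq> zv"
  shows "vec_space.rank (Suc n) (M 0) \<le> 2"
proof -
  have u0V: "u0 \<in> V" using u0 by (rule E_closed)
  define u where "u k = Tp k u0" for k
  have uE: "u k \<in> E k" for k using Tp_E[OF u0, of k] by (simp add: u_def)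
  have uV [simp]: "u k \<in> V" for k using u0V by (simp add: u_def)
  \<comment> \<open>Left and right neighbours with representatives in 0, ..., n, so that
    \<open>far\<close> decides adjacency.\<close>
  define l where "l i = (if i = 0 then n else i - 1)" for i
  define r where "r i = (if i = n then 0 else i + 1)" for i
  have far_rl: "far (r i) (l i)" if "i \<le> n" for i
    using that n4 by (auto simp: far_def l_def r_def)
  define N where "N i = M (r i) * M (l i)" for i
  have N_carrier [simp]: "N i \<in> carrier_mat (Suc n) (Suc n)" for i
    unfolding N_def by (rule mult_carrier_mat[OF M_carrier M_carrier])
  have N_app: "N i *\<^sub>v v = M (r i) *\<^sub>v (M (l i) *\<^sub>v v)" if "v \<in> V" for i v
    unfolding N_def using that by (rule assoc_mult_mat_vec[OF M_carrier M_carrier])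
  have N_kill: "N i *\<^sub>v v = zv"
    if "v \<in> V" "i \<le> n" "M (l i) *\<^sub>v v = zv \<or> M (r i) *\<^sub>v v = zv" for i v
    using that M_comm_far[OF far_rl[OF that(2)] that(1)] N_app by auto
  have N_u: "N i *\<^sub>v u k = zv" if "i \<le> n" "k \<le> n" "k \<noteq> i" for i k
  proof -
    \<comment> \<open>On a cycle of length at least 5, only \<open>i\<close> itself is within
      distance 1 of both neighbours of \<open>i\<close>.\<close>
    have "far (l i) k \<or> far (r i) k"
      using that n4 by (auto simp: far_def l_def r_def)
    then show ?thesis using N_kill[OF uV that(1)] E_far[OF uE] by blast
  qed
  have N_u_nz: "N i *\<^sub>v u i \<noteq> zv" if "i \<le> n" for i
  proof -
    have 1: "M (r i) = M (1 + i)" using period[of 0] by (auto simp: r_def)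
    have 2: "M (l i) = M (n + i)"
      using period[of "i - 1"] by (cases "i = 0") (auto simp: l_def ac_simps)
    have "N i *\<^sub>v u i = Tp i (M 1 *\<^sub>v (M n *\<^sub>v u0))"
      unfolding N_app[OF uV] 1 2 unfolding u_def M_Tp[OF u0V] M_Tp[OF M_closed[OF u0V]] ..
    then show ?thesis using nz Tp_eq_zero u0V by (metis M_closed)
  qed
  let ?P = "col_mat (Suc n) u"
  have PV: "?P *\<^sub>v a \<in> V" if "a \<in> V" for a
    using that by (rule mult_mat_vec_carrier[OF col_mat_carrier])
  have N_P: "N i *\<^sub>v (?P *\<^sub>v a) = a $ i \<cdot>\<^sub>v (N i *\<^sub>v u i)" if "a \<in> V" "i \<le> n" for i a
    using that N_u[OF that(2)] by (intro mult_col_mat_single) auto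
  have coeff_0: "a $ i = 0" if "a \<in> V" "i \<le> n" "N i *\<^sub>v (?P *\<^sub>v a) = zv" for a i
    using smult_eq_zero N_P[OF that(1,2)] that(3) N_u_nz[OF that(2)] by metis
  \<comment> \<open>A vector killed by a neighbour of \<open>M i\<close> has no coordinate at
    \<open>i\<close>, since the two neighbours commute.\<close>
  have coeff: "a $ i = 0"
    if "a \<in> V" "i \<le> n" "M (l i) *\<^sub>v (?P *\<^sub>v a) = zv \<or> M (r i) *\<^sub>v (?P *\<^sub>v a) = zv" for a i
    using coeff_0[OF that(1,2) N_kill[OF PV[OF that(1)] that(2,3)]] .
  have inj: "a = zv" if a: "a \<in> V" and "?P *\<^sub>v a = zv" for a
  proof -
    have "a $ i = 0" if "i \<le> n" for i using coeff[OF a that] \<open>?P *\<^sub>v a = zv\<close> by simp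
    then show ?thesis using a by (intro eq_vecI) auto
  qed
  have span: "\<exists>a\<in>V. w = ?P *\<^sub>v a" if "w \<in> V" for w
    using col_mat_surj[OF inj that] by blast
  show ?thesis
  proof (cases "M 0 *\<^sub>v u 0 = zv")
    case True
    show ?thesis
    proof (rule rank_le_2I)
      fix y assume "y \<in> V"
      then obtain a where a: "a \<in> V" "y = ?P *\<^sub>v a" using span by blast
      \<comment> \<open>Only the two cyclic neighbours 1 and \<open>n\<close> of 0 survive, so the
        image is spanned by two vectors.\<close>
      have "M 0 *\<^sub>v u k = zv" if "k < Suc n" "k \<noteq> 1" "k \<noteq> n" for k
      proof (cases "k = 0")
        case False
        then have "far 0 k" using that by (auto simp: far_def)
        then show ?thesis using E_far[OF uE] by blast
      qed (use True in simp)
      then have "M 0 *\<^sub>v y = a $ 1 \<cdot>\<^sub>v (M 0 *\<^sub>v u 1) + a $ n \<cdot>\<^sub>v (M 0 *\<^sub>v u n)"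
        unfolding a(2) using a n4 by (intro mult_col_mat_pair) auto
      then show "\<exists>\<alpha> \<beta>. M 0 *\<^sub>v y = \<alpha> \<cdot>\<^sub>v (M 0 *\<^sub>v u 1) + \<beta> \<cdot>\<^sub>v (M 0 *\<^sub>v u n)" by blast
    qed auto
  next
    case False
    have Mu_nz: "M k *\<^sub>v u k \<noteq> zv" for k
    proof
      assume "M k *\<^sub>v u k = zv"
      then have "Tp k (M 0 *\<^sub>v u 0) = zv" using M_Tp[OF u0V, of 0 k] by (simp add: u_def)
      then show False using False Tp_eq_zero uV M_closed by blast
    qed
    \<comment> \<open>A second test for coordinates, through \<open>M i\<close> itself; it applies
      once the other nonzero coordinates are far from \<open>i\<close>.\<close>
    have diag: "a $ i = 0" if a: "a \<in> V" and i: "i \<le> n" and z: "M i *\<^sub>v (?P *\<^sub>v a) = zv"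
      and k: "\<And>k. k \<le> n \<Longrightarrow> k \<noteq> i \<Longrightarrow> a $ k = 0 \<or> far i k" for a i
    proof -
      have "M i *\<^sub>v (?P *\<^sub>v a) = a $ i \<cdot>\<^sub>v (M i *\<^sub>v u i)"
        using a i k E_far[OF uE] by (intro mult_col_mat_single) (auto simp: less_Suc_eq_le)
      then show ?thesis using smult_eq_zero z Mu_nz by metis
    qed
    \<comment> \<open>With the identity as \<open>N\<close>, the evaluation lemmas expand the
      combination itself.\<close>
    have one: "1\<^sub>m (Suc n) *\<^sub>v v = v" if "v \<in> V" for v using that by simp
    have M_two: "M j *\<^sub>v (M k *\<^sub>v u i) = zv" if "far j k" "far j i" for i j k
      using M_comm_far[OF that(1) uV] E_far[OF uE that(2)] by simp

    \<comment> \<open>\<open>M 4\<close>, ..., \<open>M n\<close> commute with \<open>M 1\<close>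
      and kill \<open>u 2\<close>, so they kill \<open>M 1 *\<^sub>v u 2\<close> as well; this
      removes coordinates until only 1 and 2 remain.\<close>
    obtain a where a: "a \<in> V" "M 1 *\<^sub>v u 2 = ?P *\<^sub>v a" using span by (meson M_closed uV)
    have ka: "M j *\<^sub>v (?P *\<^sub>v a) = zv" if "4 \<le> j" "j \<le> n" for j
      unfolding a(2)[symmetric] using that by (intro M_two) (auto simp: far_def)
    have a0: "a $ i = 0" if "i \<le> n" "i \<noteq> 1" "i \<noteq> 2" "i \<noteq> 4" for i
      using that n4 by (intro coeff a) (auto simp: l_def r_def intro: ka)
    \<comment> \<open>Coordinate 4 escapes \<open>coeff\<close> only for n = 4, where both its
      neighbours 3 and 0 lie outside the range of \<open>ka\<close>.\<close>
    have "a $ 4 = 0"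
      using n4 by (intro diag a ka) (auto simp: far_def intro: a0)
    then have a_nz: "a $ k = 0" if "k \<le> n" "k \<noteq> 1" "k \<noteq> 2" for k
      using a0[OF that] by (cases "k = 4") simp_all
    have w1: "M 1 *\<^sub>v u 2 = a $ 1 \<cdot>\<^sub>v u 1 + a $ 2 \<cdot>\<^sub>v u 2"
    proof -
      have "1\<^sub>m (Suc n) *\<^sub>v (?P *\<^sub>v a) = a $ 1 \<cdot>\<^sub>v (1\<^sub>m (Suc n) *\<^sub>v u 1) + a $ 2 \<cdot>\<^sub>v (1\<^sub>m (Suc n) *\<^sub>v u 2)"
        using a n4 a_nz by (intro mult_col_mat_pair) auto
      then show ?thesis unfolding a(2) using one PV[OF a(1)] by simp
    qed

    obtain b where b: "b \<in> V" "M 3 *\<^sub>v u 2 = ?P *\<^sub>v b" using span by (meson M_closed uV)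
    have kb: "M j *\<^sub>v (?P *\<^sub>v b) = zv" if "j = 0 \<or> 5 \<le> j" "j \<le> n" for j
      unfolding b(2)[symmetric] using that n4 by (intro M_two) (auto simp: far_def)
    have b0: "b $ i = 0" if "i \<le> n" "i \<noteq> 2" "i \<noteq> 3" "i \<noteq> 0" for i
    proof -
      have "(l i = 0 \<or> 5 \<le> l i) \<and> l i \<le> n \<or> (r i = 0 \<or> 5 \<le> r i) \<and> r i \<le> n"
        using that n4 by (auto simp: l_def r_def)
      then show ?thesis using coeff[OF b(1) that(1)] kb by blast
    qed
    \<comment> \<open>Likewise coordinate 0 escapes \<open>coeff\<close> only for n = 4.\<close>
    have "b $ 0 = 0"
      using n4 by (intro diag b kb) (auto simp: far_def intro: b0)
    then have b_nz: "b $ k = 0" if "k \<le> n" "k \<noteq> 2" "k \<noteq> 3" for k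
      using b0[OF that] by (cases "k = 0") simp_all
    have w3: "M 3 *\<^sub>v u 2 = b $ 2 \<cdot>\<^sub>v u 2 + b $ 3 \<cdot>\<^sub>v u 3"
    proof -
      have "1\<^sub>m (Suc n) *\<^sub>v (?P *\<^sub>v b) = b $ 2 \<cdot>\<^sub>v (1\<^sub>m (Suc n) *\<^sub>v u 2) + b $ 3 \<cdot>\<^sub>v (1\<^sub>m (Suc n) *\<^sub>v u 3)"
        using b n4 b_nz by (intro mult_col_mat_pair) auto
      then show ?thesis unfolding b(2) using one PV[OF b(1)] by simp
    qed

    obtain c where c: "c \<in> V" "M 2 *\<^sub>v u 2 = ?P *\<^sub>v c" using span by (meson M_closed uV)
    have kc: "M j *\<^sub>v (?P *\<^sub>v c) = zv" if "j = 0 \<or> 4 \<le> j" "j \<le> n" for j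
      unfolding c(2)[symmetric] using that n4 by (intro M_two) (auto simp: far_def)
    have c0: "c $ i = 0" if "i \<le> n" "i \<noteq> 2" for i
    proof -
      have "(l i = 0 \<or> 4 \<le> l i) \<and> l i \<le> n \<or> (r i = 0 \<or> 4 \<le> r i) \<and> r i \<le> n"
        using that n4 by (auto simp: l_def r_def)
      then show ?thesis using coeff[OF c(1) that(1)] kc by blast
    qed
    have w2: "M 2 *\<^sub>v u 2 = c $ 2 \<cdot>\<^sub>v u 2"
    proof -
      have "1\<^sub>m (Suc n) *\<^sub>v (?P *\<^sub>v c) = c $ 2 \<cdot>\<^sub>v (1\<^sub>m (Suc n) *\<^sub>v u 2)"
        using c n4 c0 by (intro mult_col_mat_single) auto
      then show ?thesis unfolding c(2) using one PV[OF c(1)] by simp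
    qed

    \<comment> \<open>\<open>M 3\<close> kills \<open>u 1\<close> and \<open>M 1\<close> kills
      \<open>u 3\<close>, so evaluating \<open>y\<close> in both orders makes
      \<open>M 1 *\<^sub>v u 2\<close> and \<open>M 3 *\<^sub>v u 2\<close> proportional. One lies
      in the span of \<open>u 1\<close> and \<open>u 2\<close>, the other in that of
      \<open>u 2\<close> and \<open>u 3\<close>, so both lie on the line of
      \<open>u 2\<close>.\<close>
    define y where "y = M 3 *\<^sub>v (M 1 *\<^sub>v u 2)"
    have y_nz: "y \<noteq> zv" using N_u_nz[of 2] n4 by (simp add: N_app y_def l_def r_def)
    have f: "far 3 1" "far 1 3" using n4 by (auto simp: far_def)
    have y_a: "y = a $ 2 \<cdot>\<^sub>v (M 3 *\<^sub>v u 2)"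
      unfolding y_def w1 using E_far[OF uE f(1)] by (simp add: M_add M_smult)
    have y_b: "y = b $ 2 \<cdot>\<^sub>v (M 1 *\<^sub>v u 2)"
      unfolding y_def M_comm_far[OF f(1) uV] unfolding w3 using E_far[OF uE f(2)] by (simp add: M_add M_smult)
    have a2: "a $ 2 \<noteq> 0" using y_nz y_a smult_0_vec[of "M 3 *\<^sub>v u 2"] by auto
    have b2: "b $ 2 \<noteq> 0" using y_nz y_b smult_0_vec[of "M 1 *\<^sub>v u 2"] by auto
    have eq: "a $ 2 \<cdot>\<^sub>v (?P *\<^sub>v b) = b $ 2 \<cdot>\<^sub>v (?P *\<^sub>v a)" using y_a y_b a(2) b(2) by simp
    \<comment> \<open>Coordinates of the two sides of \<open>eq\<close> are compared by applying
      \<open>N i\<close>.\<close>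
    have Neq: "a $ 2 * b $ i = b $ 2 * a $ i" if i: "i \<le> n" for i
    proof -
      have sm: "N i *\<^sub>v (d \<cdot>\<^sub>v v) = d \<cdot>\<^sub>v (N i *\<^sub>v v)" if "v \<in> V" for d v
        using that by (rule mult_mat_vec[OF N_carrier])
      have "(a $ 2 * b $ i) \<cdot>\<^sub>v (N i *\<^sub>v u i) = (b $ 2 * a $ i) \<cdot>\<^sub>v (N i *\<^sub>v u i)"
        using arg_cong[OF eq, of "\<lambda>v. N i *\<^sub>v v"] N_P[OF a(1) i] N_P[OF b(1) i]
        by (simp add: sm PV a(1) b(1) smult_smult_assoc)
      then have "(a $ 2 * b $ i - b $ 2 * a $ i) \<cdot>\<^sub>v (N i *\<^sub>v u i) = zv"
        (is "?d \<cdot>\<^sub>v ?w = zv")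
      proof (intro eq_vecI)
        assume eq: "(a $ 2 * b $ i) \<cdot>\<^sub>v ?w = (b $ 2 * a $ i) \<cdot>\<^sub>v ?w"
        have dim: "dim_vec ?w = Suc n" using carrier_matD(1)[OF N_carrier] by simp
        fix t assume "t < dim_vec zv"
        then have t: "t < dim_vec ?w" using dim by simp
        show "(?d \<cdot>\<^sub>v ?w) $ t = zv $ t"
          using arg_cong[OF eq, of "\<lambda>v. v $ t"] t dim
          by (simp add: left_diff_distrib del: index_mult_mat_vec dim_mult_mat_vec)
      qed (use carrier_matD(1)[OF N_carrier] in simp)
      then show ?thesis using smult_eq_zero N_u_nz[OF i] by (metis eq_iff_diff_eq_0)
    qed
    have "a $ 1 = 0" using Neq[of 1] b_nz[of 1] b2 n4 by simp
    moreover have "b $ 3 = 0" using Neq[of 3] a_nz[of 3] a2 n4 by simp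
    moreover have "0 \<cdot>\<^sub>v u 1 = zv" "0 \<cdot>\<^sub>v u 3 = zv" by (simp_all add: smult_0_vec)
    ultimately have lines: "M 1 *\<^sub>v u 2 = a $ 2 \<cdot>\<^sub>v u 2" "M 3 *\<^sub>v u 2 = b $ 2 \<cdot>\<^sub>v u 2"
      using w1 w3 by simp_all
    have "u 2 = zv"
    proof (rule no_common_eigenvector[OF uV])
      fix j assume "j < n"
      then consider "far j 2" | "j = 1" | "j = 2" | "j = 3" using n4 unfolding far_def by linarith
      then show "\<exists>c. M j *\<^sub>v u 2 = c \<cdot>\<^sub>v u 2"
      proof cases
        case 1
        then have "M j *\<^sub>v u 2 = 0 \<cdot>\<^sub>v u 2" using E_far[OF uE] smult_0_vec[OF uV] by simp
        then show ?thesis by blast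
      qed (use lines w2 in blast)+
    qed
    then have False using Mu_nz[of 2] by simp
    then show ?thesis ..
  qed
qed

theorem rank_eq_2:
  assumes "v \<in> E 0" "v \<noteq> zv"
  shows "vec_space.rank (Suc n) (M 0) = 2"
proof -
  have "vec_space.rank (Suc n) (M 0) \<le> 2"
  proof (cases "\<exists>u\<in>E 0. M 1 *\<^sub>v (M n *\<^sub>v u) \<noteq> zv")
    case True
    then show ?thesis using rank_le_2_if_not_E_M_closed by blast
  next
    case False
    have "M (k + 1) *\<^sub>v (M (k + n) *\<^sub>v w) = zv" if w: "w \<in> E k" for k w
    proof -
      \<comment> \<open>T^(kn) moves index k to k(n+1), which is 0 modulo n+1; the assumption about
        \<open>E 0\<close> is thus transported to every \<open>E k\<close>.\<close>
      have "Tp (k * n) w \<in> E (k + k * n)" by (rule Tp_E[OF w])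
      moreover have "(k * Suc n) mod Suc n = 0" by (rule mod_mult_self2_is_0)
      then have "E (k + k * n) = E 0" using E_mod[of "k * Suc n"] by simp
      ultimately have "M 1 *\<^sub>v (M n *\<^sub>v Tp (k * n) w) = zv" using False by blast
      moreover have "M 1 = M (k + 1 + k * n)" "M n = M (k + n + k * n)"
        using M_mod[of "1 + k * Suc n"] M_mod[of 1] M_mod[of "n + k * Suc n"] M_mod[of n]
        by (simp_all only: mod_mult_self1) (simp_all add: ac_simps)
      ultimately have "Tp (k * n) (M (k + 1) *\<^sub>v (M (k + n) *\<^sub>v w)) = zv"
        using M_Tp[of "M (k + n) *\<^sub>v w" "k + 1" "k * n"] M_Tp[of w "k + n" "k * n"] E_closed[OF w] by simp
      then show ?thesis using Tp_eq_zero E_closed[OF w] by (meson M_closed)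
    qed
    from rank_le_2_if_image_subset_E[OF image_subset_E[OF this assms]] show ?thesis .
  qed
  then show ?thesis using rank_ge_2 by simp
qed

end

section \<open>The cyclic system of a braid representation\<close>

lemma intertwine_minus_smult_one:
  fixes P A C :: "complex mat"
  assumes P: "P \<in> carrier_mat d d" and A: "A \<in> carrier_mat d d" and C: "C \<in> carrier_mat d d"
    and eq: "P * A = C * P"
  shows "P * (A - x \<cdot>\<^sub>m 1\<^sub>m d) = (C - x \<cdot>\<^sub>m 1\<^sub>m d) * P"
proof -
  have I: "x \<cdot>\<^sub>m 1\<^sub>m d \<in> carrier_mat d d" by simp
  have "P * (x \<cdot>\<^sub>m 1\<^sub>m d) = (x \<cdot>\<^sub>m 1\<^sub>m d) * P"
    using P mult_smult_distrib[OF P one_carrier_mat, of x] mult_smult_assoc_mat[OF one_carrier_mat P, of x]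
    by simp
  then show ?thesis
    using mult_minus_distrib_mat[OF P A I] minus_mult_distrib_mat[OF C I P] eq by simp
qed

lemma invertible_mat_det_nonzero:
  fixes A :: "complex mat"
  assumes A: "A \<in> carrier_mat d d" and inv: "invertible_mat A"
  shows "det A \<noteq> 0"
proof -
  obtain B where B: "A * B = 1\<^sub>m d" "B * A = 1\<^sub>m (dim_row B)"
    using inv A unfolding invertible_mat_def inverts_mat_def by auto
  have "dim_col B = d" "dim_row B = d"
    using arg_cong[OF B(1), of dim_col] arg_cong[OF B(2), of dim_col] A by simp_all
  then have "B \<in> carrier_mat d d" by auto
  then have "det A * det B = 1" using det_mult[OF A] B(1) by (metis det_one)
  then show ?thesis by auto
qed

lemma smult_one_mat_mult_vec:
  fixes w :: "complex vec"
  assumes "w \<in> carrier_vec d"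
  shows "(x \<cdot>\<^sub>m 1\<^sub>m d) *\<^sub>v w = x \<cdot>\<^sub>v w"
proof (rule eq_vecI)
  fix r assume "r < dim_vec (x \<cdot>\<^sub>v w)"
  then have r: "r < d" using assms by simp
  have "row (x \<cdot>\<^sub>m 1\<^sub>m d) r = x \<cdot>\<^sub>v unit_vec d r" using r by (intro eq_vecI) auto
  then show "((x \<cdot>\<^sub>m 1\<^sub>m d) *\<^sub>v w) $ r = (x \<cdot>\<^sub>v w) $ r" using assms r by simp
qed (use assms in simp)

section \<open>Products of braid generators\<close>

text \<open>The product \<sigma>_1 ... \<sigma>_m. With \<open>s\<close> as a parameter, the shifted
  product \<sigma>_2 ... \<sigma>_{m+1} is another instance.\<close>

primrec gen_prod :: "nat \<Rightarrow> (nat \<Rightarrow> complex mat) \<Rightarrow> nat \<Rightarrow> complex mat" where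
  "gen_prod d s 0 = 1\<^sub>m d"
| "gen_prod d s (Suc m) = gen_prod d s m * s (Suc m)"

lemma gen_prod_carrier:
  "(\<And>i. 1 \<le> i \<Longrightarrow> i \<le> m \<Longrightarrow> s i \<in> carrier_mat d d) \<Longrightarrow> gen_prod d s m \<in> carrier_mat d d"
proof (induction m)
  case (Suc m)
  then show ?case by (auto intro!: mult_carrier_mat[of _ d d])
qed simp

locale braid_matrices =
  fixes n d :: nat and s :: "nat \<Rightarrow> complex mat"
  assumes s_carrier: "1 \<le> i \<Longrightarrow> i \<le> n \<Longrightarrow> s i \<in> carrier_mat d d"
    and s_inv: "1 \<le> i \<Longrightarrow> i \<le> n \<Longrightarrow> invertible_mat (s i)"
    and s_comm: "1 \<le> i \<Longrightarrow> i + 2 \<le> j \<Longrightarrow> j \<le> n \<Longrightarrow> s i * s j = s j * s i"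
    and s_braid: "1 \<le> i \<Longrightarrow> i < n \<Longrightarrow> s i * s (Suc i) * s i = s (Suc i) * s i * s (Suc i)"
begin

abbreviation "Q \<equiv> gen_prod d s"
abbreviation "R \<equiv> gen_prod d (\<lambda>i. s (Suc i))"
abbreviation "T \<equiv> Q n"

lemma Q_carrier: "m \<le> n \<Longrightarrow> Q m \<in> carrier_mat d d"
  by (rule gen_prod_carrier) (simp add: s_carrier)

lemma R_carrier: "m < n \<Longrightarrow> R m \<in> carrier_mat d d"
  by (rule gen_prod_carrier) (simp add: s_carrier)

lemma T_carrier: "T \<in> carrier_mat d d"
  by (rule Q_carrier) simp

lemmas mat_assoc = assoc_mult_mat[of _ d d _ d _ d]

lemma Q_comm:
  "m + 2 \<le> j \<Longrightarrow> j \<le> n \<Longrightarrow> Q m * s j = s j * Q m"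
proof (induction m)
  case 0
  then show ?case using s_carrier[of j] by simp
next
  case (Suc m)
  have c: "Q m \<in> carrier_mat d d" "s (Suc m) \<in> carrier_mat d d" "s j \<in> carrier_mat d d"
    using Suc.prems Q_carrier s_carrier by auto
  have "Q (Suc m) * s j = Q m * (s (Suc m) * s j)" using c by (simp add: mat_assoc)
  also have "\<dots> = Q m * (s j * s (Suc m))" using s_comm[of "Suc m" j] Suc.prems by simp
  also have "\<dots> = Q m * s j * s (Suc m)" using c by (simp add: mat_assoc)
  also have "\<dots> = s j * Q m * s (Suc m)" using Suc by simp
  also have "\<dots> = s j * Q (Suc m)" using c by (simp add: mat_assoc)
  finally show ?case .
qed

text \<open>Each new last factor commutes with \<sigma>_i, except the factor \<sigma>_{i+1}. There
  the braid relation moves \<sigma>_{i+1} to the left of \<sigma>_i, and it passes the remaining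
  product by \<open>Q_comm\<close>.\<close>

lemma Q_shift:
  "1 \<le> i \<Longrightarrow> Suc i \<le> m \<Longrightarrow> m \<le> n \<Longrightarrow> Q m * s i = s (Suc i) * Q m"
proof (induction m)
  case (Suc m)
  show ?case
  proof (cases "m = i")
    case True
    then obtain k where k: "i = Suc k" "m = Suc k" using Suc.prems by (cases i) auto
    have c: "Q k \<in> carrier_mat d d" "s (Suc k) \<in> carrier_mat d d" "s (Suc (Suc k)) \<in> carrier_mat d d"
      using Suc.prems k Q_carrier s_carrier by auto
    have "Q (Suc m) * s i = Q k * (s (Suc k) * s (Suc (Suc k)) * s (Suc k))"
      using c k by (simp add: mat_assoc)
    also have "\<dots> = Q k * (s (Suc (Suc k)) * s (Suc k) * s (Suc (Suc k)))"
      using s_braid[of "Suc k"] Suc.prems k by simp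
    also have "\<dots> = Q k * s (Suc (Suc k)) * s (Suc k) * s (Suc (Suc k))"
      using c by (simp add: mat_assoc)
    also have "\<dots> = s (Suc (Suc k)) * Q k * s (Suc k) * s (Suc (Suc k))"
      using Q_comm[of k "Suc (Suc k)"] Suc.prems k by simp
    also have "\<dots> = s (Suc i) * Q (Suc m)" using c k by (simp add: mat_assoc)
    finally show ?thesis .
  next
    case False
    have c: "Q m \<in> carrier_mat d d" "s (Suc m) \<in> carrier_mat d d" "s i \<in> carrier_mat d d"
      "s (Suc i) \<in> carrier_mat d d"
      using Suc.prems Q_carrier s_carrier by auto
    have "Q (Suc m) * s i = Q m * (s (Suc m) * s i)" using c by (simp add: mat_assoc)
    also have "\<dots> = Q m * (s i * s (Suc m))" using s_comm[of i "Suc m"] Suc.prems False by simp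
    also have "\<dots> = Q m * s i * s (Suc m)" using c by (simp add: mat_assoc)
    also have "\<dots> = s (Suc i) * Q m * s (Suc m)" using Suc False by simp
    also have "\<dots> = s (Suc i) * Q (Suc m)" using c by (simp add: mat_assoc)
    finally show ?thesis .
  qed
qed simp

lemma T_Q: "m < n \<Longrightarrow> T * Q m = R m * T"
proof (induction m)
  case 0
  then show ?case using T_carrier by simp
next
  case (Suc m)
  have c: "T \<in> carrier_mat d d" "Q m \<in> carrier_mat d d" "R m \<in> carrier_mat d d" "s (Suc m) \<in> carrier_mat d d"
    "s (Suc (Suc m)) \<in> carrier_mat d d"
    using Suc.prems T_carrier Q_carrier R_carrier s_carrier by auto
  have "T * Q (Suc m) = T * Q m * s (Suc m)" using c by (simp add: mat_assoc)
  also have "\<dots> = R m * (T * s (Suc m))" using Suc c by (simp add: mat_assoc)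
  also have "\<dots> = R m * (s (Suc (Suc m)) * T)" using Q_shift[of "Suc m" n] Suc.prems by simp
  also have "\<dots> = R (Suc m) * T" using c by (simp add: mat_assoc)
  finally show ?case .
qed

lemma Q_Suc_eq: "m < n \<Longrightarrow> Q (Suc m) = s 1 * R m"
proof (induction m)
  case 0
  then show ?case using s_carrier[of 1] by simp
next
  case (Suc m)
  have "s 1 \<in> carrier_mat d d" "R m \<in> carrier_mat d d" "s (Suc (Suc m)) \<in> carrier_mat d d"
    using Suc.prems R_carrier s_carrier by auto
  then show ?case using Suc by (simp add: mat_assoc)
qed

text \<open>Split off the last factor of one \<open>T\<close> and the first factor of the other, T =
  Q_{n-1} \<sigma>_n = \<sigma>_1 R_{n-1}, and use T Q_{n-1} = R_{n-1} T.\<close>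

lemma T_T_last:
  assumes "0 < n"
  shows "T * T * s n = s 1 * (T * T)"
proof -
  obtain m where m: "n = Suc m" using assms by (cases n) auto
  have c: "T \<in> carrier_mat d d" "Q m \<in> carrier_mat d d" "R m \<in> carrier_mat d d" "s 1 \<in> carrier_mat d d"
    "s n \<in> carrier_mat d d"
    using m T_carrier Q_carrier R_carrier s_carrier by auto
  have T1: "T = Q m * s n" and T2: "T = s 1 * R m" using m Q_Suc_eq[of m] by simp_all
  have "s 1 * (T * T) = s 1 * (T * (Q m * s n))" using T1 by simp
  also have "\<dots> = s 1 * (T * Q m * s n)" using assoc_mult_mat[OF c(1,2,5)] by simp
  also have "\<dots> = s 1 * (R m * T * s n)" using T_Q[of m] m by simp
  also have "\<dots> = s 1 * R m * T * s n"
    using c assoc_mult_mat[OF c(4) mult_carrier_mat[OF c(3,1)] c(5)] assoc_mult_mat[OF c(4,3,1)] by simp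
  also have "\<dots> = T * T * s n" using T2 by simp
  finally show ?thesis by simp
qed

lemma det_Q: "m \<le> n \<Longrightarrow> det (Q m) \<noteq> 0"
proof (induction m)
  case (Suc m)
  have c: "s (Suc m) \<in> carrier_mat d d" using s_carrier Suc.prems by auto
  then have "det (s (Suc m)) \<noteq> 0" using s_inv[of "Suc m"] invertible_mat_det_nonzero[OF c] Suc.prems by simp
  then show ?case using Suc det_mult[OF Q_carrier[of m] c] by simp
qed simp

lemma T_inverse:
  obtains Ti where "Ti \<in> carrier_mat d d" "Ti * T = 1\<^sub>m d" "T * Ti = 1\<^sub>m d"
  using det_non_zero_imp_unit[OF T_carrier det_Q[OF order_refl]]
  by (auto simp: Units_def ring_mat_def)

section \<open>Common eigenvectors of adjacent generators\<close>

text \<open>On \<open>v\<close> the braid relation reads aba = bab, and invertibility makes both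
  eigenvalues nonzero.\<close>

lemma eigenvalue_unique:
  assumes v: "v \<in> carrier_vec d" "v \<noteq> 0\<^sub>v d" and i: "1 \<le> i" "i < n"
    and eig: "s i *\<^sub>v v = a \<cdot>\<^sub>v v" "s (Suc i) *\<^sub>v v = b \<cdot>\<^sub>v v"
  shows "a = b"
proof -
  have c: "s i \<in> carrier_mat d d" "s (Suc i) \<in> carrier_mat d d" using s_carrier i by auto
  obtain r where r: "r < d" "v $ r \<noteq> 0"
    using v by (metis carrier_vecD eq_vecI index_zero_vec)
  have nz: "e \<noteq> 0" if "A \<in> carrier_mat d d" "invertible_mat A" "A *\<^sub>v v = e \<cdot>\<^sub>v v" for A e
  proof
    assume "e = 0"
    then have "A *\<^sub>v v = 0\<^sub>v d" using that v by (intro eq_vecI) auto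
    then show False
      using invertible_mat_det_nonzero[OF that(1,2)] det_0_iff_vec_prod_zero[OF that(1)] v by blast
  qed
  have ab: "a \<noteq> 0" "b \<noteq> 0"
    using nz[OF c(1) s_inv eig(1)] nz[OF c(2) s_inv eig(2)] i by auto
  have app: "(A * B * C) *\<^sub>v v = (e * f * g) \<cdot>\<^sub>v v"
    if "A \<in> carrier_mat d d" "B \<in> carrier_mat d d" "C \<in> carrier_mat d d"
      "A *\<^sub>v v = e \<cdot>\<^sub>v v" "B *\<^sub>v v = f \<cdot>\<^sub>v v" "C *\<^sub>v v = g \<cdot>\<^sub>v v" for A B C e f g
  proof -
    have "(A * B * C) *\<^sub>v v = (A * B) *\<^sub>v (C *\<^sub>v v)"
      by (rule assoc_mult_mat_vec[OF mult_carrier_mat[OF that(1,2)] that(3) v(1)])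
    also have "\<dots> = g \<cdot>\<^sub>v (A *\<^sub>v (B *\<^sub>v v))"
      using that v mult_mat_vec[OF mult_carrier_mat[OF that(1,2)] v(1)]
        assoc_mult_mat_vec[OF that(1,2) v(1)] by simp
    also have "\<dots> = (e * f * g) \<cdot>\<^sub>v v"
      using that v mult_mat_vec[OF that(1) v(1)] by (simp add: smult_smult_assoc ac_simps)
    finally show ?thesis .
  qed
  have "(a * b * a) \<cdot>\<^sub>v v = (b * a * b) \<cdot>\<^sub>v v"
    using app[OF c(1) c(2) c(1) eig(1) eig(2) eig(1)] app[OF c(2) c(1) c(2) eig(2) eig(1) eig(2)]
      s_braid[OF i] by simp
  then have "(a * b * a) * v $ r = (b * a * b) * v $ r"
    using r v by (metis carrier_vecD index_smult_vec(1))
  then show ?thesis using r ab by simp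
qed

lemma eigenvalue_const:
  assumes v: "v \<in> carrier_vec d" "v \<noteq> 0\<^sub>v d" and m: "m \<le> n"
    and eig: "\<And>i. 1 \<le> i \<Longrightarrow> i \<le> m \<Longrightarrow> \<exists>c. s i *\<^sub>v v = c \<cdot>\<^sub>v v"
  shows "\<exists>x. \<forall>i. 1 \<le> i \<and> i \<le> m \<longrightarrow> s i *\<^sub>v v = x \<cdot>\<^sub>v v"
  using m eig
proof (induction m)
  case (Suc m)
  then obtain x where x: "\<And>i. 1 \<le> i \<Longrightarrow> i \<le> m \<Longrightarrow> s i *\<^sub>v v = x \<cdot>\<^sub>v v" by (metis Suc_leD le_SucI)
  obtain y where y: "s (Suc m) *\<^sub>v v = y \<cdot>\<^sub>v v" using Suc.prems(2)[of "Suc m"] by auto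
  have "x = y" if "1 \<le> m"
    using eigenvalue_unique[OF v that _ x y] Suc.prems that by simp
  then have "s i *\<^sub>v v = y \<cdot>\<^sub>v v" if "1 \<le> i" "i \<le> Suc m" for i
    using that x[of i] y by (cases "i = Suc m") auto
  then show ?case by blast
qed simp

end

section \<open>The rank theorem for braid representations\<close>

theorem theorem2:
  fixes n :: nat and s :: "nat \<Rightarrow> complex mat"
  assumes "n \<ge> 4"
    and "irreducible_braid_rep (n+1) (n+1) s"
    and "\<exists>v \<in> carrier_vec (n+1). v \<noteq> 0\<^sub>v (n+1) \<and>
           (\<forall>i \<in> {1..n-2} \<union> {n}. \<exists>c::complex. s i *\<^sub>v v = c \<cdot>\<^sub>v v)"
  shows "\<exists>y::complex. y \<noteq> 0 \<and> vec_space.rank (n+1) (s 1 - y \<cdot>\<^sub>m 1\<^sub>m (n+1)) = 2"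
proof -
  let ?d = "Suc n"
  have rep: "braid_rep ?d ?d s"
    and irr: "\<And>W. cplx_subspace ?d W \<Longrightarrow> (\<And>i w. 1 \<le> i \<Longrightarrow> i \<le> n \<Longrightarrow> w \<in> W \<Longrightarrow> s i *\<^sub>v w \<in> W)
      \<Longrightarrow> W = {0\<^sub>v ?d} \<or> W = carrier_vec ?d"
    using assms(2) by (auto simp: irreducible_braid_rep_def)
  interpret braid_matrices n ?d s
  proof
    fix i j assume "1 \<le> i" "i + 2 \<le> j" "j \<le> n"
    moreover from this have "i \<in> {1..<?d}" "j \<in> {1..<?d}" by auto
    ultimately show "s i * s j = s j * s i" using rep unfolding braid_rep_def by blast
  qed (use rep in \<open>auto simp: braid_rep_def\<close>)
  obtain v where v: "v \<in> carrier_vec ?d" "v \<noteq> 0\<^sub>v ?d"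
    and eig: "\<And>i. 1 \<le> i \<Longrightarrow> i \<le> n - 2 \<Longrightarrow> \<exists>c. s i *\<^sub>v v = c \<cdot>\<^sub>v v"
    using assms(3) by auto
  obtain x where x: "\<And>i. 1 \<le> i \<Longrightarrow> i \<le> n - 2 \<Longrightarrow> s i *\<^sub>v v = x \<cdot>\<^sub>v v"
    using eigenvalue_const[OF v _ eig] by (metis diff_le_self)
  obtain Ti where Ti: "Ti \<in> carrier_mat ?d ?d" "Ti * T = 1\<^sub>m ?d" "T * Ti = 1\<^sub>m ?d"
    by (rule T_inverse)
  define A where "A i = s i - x \<cdot>\<^sub>m 1\<^sub>m ?d" for i
  have A_carrier: "A i \<in> carrier_mat ?d ?d" for i unfolding A_def by (rule minus_carrier_mat) simp
  have A_app: "A i *\<^sub>v w = s i *\<^sub>v w - x \<cdot>\<^sub>v w" if "1 \<le> i" "i \<le> n" "w \<in> carrier_vec ?d" for i w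
    unfolding A_def using that s_carrier[of i]
    by (simp add: minus_mult_distrib_mat_vec[of _ ?d ?d] smult_one_mat_mult_vec)
  \<comment> \<open>Iterated conjugation gives \<open>shift\<close> for all indices at once; what
    remains to be shown is that the sequence starts with the n generators and closes up after n+1
    steps.\<close>
  define M where "M j = ((\<lambda>B. T * B * Ti) ^^ j) (A 1)" for j
  have M_0: "M 0 = A 1" and M_Suc: "M (Suc j) = T * M j * Ti" for j by (simp_all add: M_def)
  have M_carrier: "M j \<in> carrier_mat ?d ?d" for j
    by (induction j) (use M_0 M_Suc A_carrier T_carrier Ti in auto)
  have conj: "T * B * Ti = C" if "B \<in> carrier_mat ?d ?d" "C \<in> carrier_mat ?d ?d" "T * B = C * T" for B C
    using that Ti T_carrier by (simp add: mat_assoc)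
  have M_A: "j < n \<Longrightarrow> M j = A (Suc j)" for j
  proof (induction j)
    case (Suc j)
    have "T * A (Suc j) = A (Suc (Suc j)) * T"
      unfolding A_def using Suc.prems
      by (intro intertwine_minus_smult_one T_carrier s_carrier Q_shift) auto
    then show ?case using Suc conj[OF A_carrier A_carrier] by (simp add: M_Suc)
  qed (simp add: M_0)
  have shift: "T * M j = M (Suc j) * T" for j
    using M_carrier[of j] T_carrier Ti by (simp add: M_Suc mat_assoc)
  \<comment> \<open>M_{n+1} = T^2 A_n T^(-2), which \<open>T_T_last\<close> identifies with
    A_1.\<close>
  have last: "M (Suc n) = M 0"
  proof -
    have n: "n = Suc (n - 1)" using assms(1) by simp
    have TT: "T * T \<in> carrier_mat ?d ?d" using T_carrier by simp
    have "T * T * A n = A 1 * (T * T)"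
      unfolding A_def using assms(1)
      by (intro intertwine_minus_smult_one TT s_carrier T_T_last) auto
    moreover have "M (Suc n) = T * (T * M (n - 1) * Ti) * Ti" using M_Suc[of n] M_Suc[of "n - 1"] n by simp
    then have "M (Suc n) = T * T * A n * Ti * Ti"
      using M_A[of "n - 1"] n A_carrier[of n] T_carrier Ti(1) by (simp add: mat_assoc)
    ultimately have "M (Suc n) = A 1 * (T * (T * Ti) * Ti)"
      using A_carrier[of 1] T_carrier Ti(1) by (simp add: mat_assoc)
    then show ?thesis using Ti T_carrier A_carrier[of 1] by (simp add: M_0)
  qed
  have period: "M (Suc (j + n)) = M j" for j
    by (induction j) (use last M_Suc in auto)
  \<comment> \<open>For k = 0 both operators come from actual generators, as i < n; conjugation by
    \<open>T\<close> then carries the relation to all \<open>k\<close>, also across the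
    wrap.\<close>
  have comm: "M k * M (k + i) = M (k + i) * M k" if i: "2 \<le> i" "i < n" for i k
  proof (induction k)
    case 0
    have c: "s 1 \<in> carrier_mat ?d ?d" "s (Suc i) \<in> carrier_mat ?d ?d" using s_carrier i by auto
    \<comment> \<open>The scalar is subtracted from one factor at a time.\<close>
    have "s 1 * A (Suc i) = A (Suc i) * s 1"
      unfolding A_def using i s_comm[of 1 "Suc i"] by (intro intertwine_minus_smult_one c) auto
    then have "A (Suc i) * A 1 = A 1 * A (Suc i)"
      unfolding A_def[of 1] using c A_carrier by (intro intertwine_minus_smult_one) auto
    then show ?case using M_A[OF i(2)] by (simp add: M_0)
  next
    case (Suc k)
    have prod: "M (Suc a) * M (Suc b) = T * (M a * M b) * Ti" for a b
    proof -
      have "M (Suc a) * M (Suc b) = T * M a * (Ti * T) * M b * Ti"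
        unfolding M_Suc using M_carrier[of a] M_carrier[of b] T_carrier Ti(1) by (simp add: mat_assoc)
      then show ?thesis using M_carrier[of a] M_carrier[of b] T_carrier Ti by (simp add: mat_assoc)
    qed
    show ?case using prod[of k "k + i"] prod[of "k + i" k] Suc by simp
  qed
  have s_eq: "s i *\<^sub>v w = M (i - 1) *\<^sub>v w + x \<cdot>\<^sub>v w"
    if "1 \<le> i" "i \<le> n" "w \<in> carrier_vec ?d" for i w
  proof -
    have "M (i - 1) = A i" using M_A[of "i - 1"] that by simp
    then show ?thesis using A_app[OF that] s_carrier[OF that(1,2)] that(3) by (intro eq_vecI) auto
  qed
  interpret cyclic_irreducible n T Ti M
  proof unfold_locales
    fix W assume W: "cplx_subspace ?d W" and inv: "\<And>j w. j < n \<Longrightarrow> w \<in> W \<Longrightarrow> M j *\<^sub>v w \<in> W"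
    show "W = {0\<^sub>v ?d} \<or> W = carrier_vec ?d"
    proof (rule irr[OF W])
      fix i w assume i: "1 \<le> i" "i \<le> n" and w: "w \<in> W"
      then have "w \<in> carrier_vec ?d" "M (i - 1) *\<^sub>v w \<in> W" "x \<cdot>\<^sub>v w \<in> W"
        using W inv by (auto simp: cplx_subspace_def)
      then show "s i *\<^sub>v w \<in> W" using W s_eq[OF i] by (simp add: cplx_subspace_def)
    qed
  qed (use assms(1) T_carrier Ti M_carrier shift period comm in auto)
  have Mv: "M j *\<^sub>v v = 0\<^sub>v ?d" if "j < n - 2" for j
  proof -
    have "M j = A (Suc j)" using M_A[of j] that by simp
    then show ?thesis using A_app[of "Suc j" v] x[of "Suc j"] that v(1) by simp
  qed
  have "v \<in> E (n - 1)"
    unfolding E_def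
  proof (intro CollectI conjI ballI v(1))
    fix i assume i: "i \<in> {2..<n}"
    \<comment> \<open>Modulo n+1 the indices defining \<open>E (n-1)\<close> are 0, ..., n-3,
      exactly those covered by \<open>Mv\<close>; two rotations then lead to
      \<open>E 0\<close>.\<close>
    then have "n - 1 + i = Suc ((i - 2) + n)" by auto
    then have "M (n - 1 + i) = M (i - 2)" using period by simp
    then show "M (n - 1 + i) *\<^sub>v v = 0\<^sub>v ?d" using Mv[of "i - 2"] i by auto
  qed
  then have "Tp 2 v \<in> E (n - 1 + 2)" by (rule Tp_E)
  moreover have "n - 1 + 2 = Suc n" using assms(1) by simp
  ultimately have "Tp 2 v \<in> E 0" using E_mod[of "Suc n"] by simp
  moreover have "Tp 2 v \<noteq> 0\<^sub>v ?d" using Tp_eq_zero v by blast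
  ultimately have "vec_space.rank ?d (M 0) = 2" by (rule rank_eq_2)
  \<comment> \<open>The required scalar is \<open>x\<close>, an eigenvalue of the invertible matrix
    \<open>s 1\<close>.\<close>
  moreover have "x \<noteq> 0"
  proof
    assume "x = 0"
    then have "s 1 *\<^sub>v v = 0\<^sub>v ?d" using x[of 1] v assms(1) smult_0_vec by simp
    moreover have "det (s 1) \<noteq> 0" using invertible_mat_det_nonzero[OF s_carrier s_inv] assms(1) by simp
    ultimately show False using det_0_iff_vec_prod_zero[OF s_carrier, of 1] v assms(1) by auto
  qed
  ultimately show ?thesis by (auto simp: M_0 A_def)
qed

end
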